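(* Consider either a scalar conservation law or the one-dimensional compressible Euler equations for a perfect gas, discretized by the active flux (AF) scheme described in the context, with the SSP-RK3 time discretization and with the bound-preserving (BP) limitings of the context applied in every forward-Euler stage. Suppose the initial numerical data satisfy $\overline{\boldsymbol U}_i^0\in\mathcal G$ and $\boldsymbol U_{i+\frac12}^0\in\mathcal G$ for all $i$, and suppose that the time step sizes satisfy, for all $i$, $$\Delta t^n\le \frac{\Delta x_i}{\alpha_{i-\frac12}+\alpha_{i+\frac12}},\qquad \Delta t^n\le\frac{\Delta x_i+\Delta x_{i+1}}{4\max\{\alpha_i,\alpha_{i+1}\}},$$ where the $\alpha$'s are those computed from the data entering the forward-Euler stage in question (for every stage of every time step). Then: (1) In the scalar case, the scheme with the scalar BP limitings preserves the maximum principle: $m_0\le \bar u_i^n\le M_0$ and $m_0\le u_{i+\frac12}^n\le M_0$ for all $i$ and all $n\ge 0$. (2) In the Euler case, the scheme with the Euler BP limitings preserves positivity of density and pressure: $\overline{\boldsymbol U}_i^n$ and $\boldsymbol U_{i+\frac12}^n$ have positive density and positive pressure for all $i$ and all $n\ge 0$.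
   Context: **Equations and admissible sets.** The conservation law is $\partial_t\boldsymbol U+\partial_x\boldsymbol F(\boldsymbol U)=0$. - Scalar case: $\boldsymbol U=u\in\mathbb R$, $\boldsymbol F=f$, with initial data $u_0$, $m_0=\min_x u_0(x)$, $M_0=\max_x u_0(x)$, and $\mathcal G=\{u: m_0\le u\le M_0\}$. - Euler case: $\boldsymbol U=(\rho,\rho v,E)^\top$, $\boldsymbol F=(\rho v,\rho v^2+p,(E+p)v)^\top$, $p=p(\boldsymbol U)=(\gamma-1)\left(E-\frac{(\rho v)^2}{2\rho}\right)$, $\gamma>1$, and $\mathcal G=\{\boldsymbol U:\rho>0,\ p(\boldsymbol U)>0\}$. Superscripts $\rho,\rho v,E$ denote the corresponding components of a vector. The eigenvalues of $\partial\boldsymbol F/\partial\boldsymbol U$ are $v$, $v\pm\sqrt{\gamma p/\rho}$. **Mesh and unknowns.** Cells $I_i=[x_{i-\frac12},x_{i+\frac12}]$ with sizes $\Delta x_i>0$, indexed by $i\in\mathbb Z$ (a finite mesh with periodic boundary conditions being a special case). Unknowns: cell averages $\overline{\boldsymbol U}_i$ and interface point values $\boldsymbol U_{i+\frac12}$. **Semi-discrete AF scheme.** $$\frac{d\overline{\boldsymbol U}_i}{dt}=-\frac1{\Delta x_i}\left[\boldsymbol F(\boldsymbol U_{i+\frac12})-\boldsymbol F(\boldsymbol U_{i-\frac12})\right],$$ $$\frac{d\boldsymbol U_{i+\frac12}}{dt}=-\boldsymbol{\mathcal R}\left(\boldsymbol U_{i+\frac12-l_1},\overline{\boldsymbol U}_{i+1-l_1},\dots,\overline{\boldsymbol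 U}_{i+l_2},\boldsymbol U_{i+\frac12+l_2}\right),\quad l_1,l_2\ge0,$$ where $\boldsymbol{\mathcal R}$ is a consistent approximation of $\partial\boldsymbol F/\partial x$ at $x_{i+\frac12}$. **SSP-RK3 with limiting.** Let $V=(\overline{\boldsymbol U}_i,\boldsymbol U_{i+\frac12})_i$ and let $\mathcal E_{\Delta t}(V)$ be the result of one limited forward-Euler step of size $\Delta t$ starting from $V$ (defined below). Then $V^*=\mathcal E_{\Delta t^n}(V^n)$, $V^{**}=\frac34V^n+\frac14\mathcal E_{\Delta t^n}(V^* )$, $V^{n+1}=\frac13V^n+\frac23\mathcal E_{\Delta t^n}(V^{**})$. **Limited forward-Euler step.** Start from data denoted $\overline{\boldsymbol U}_i,\boldsymbol U_{i+\frac12}$, with step $\Delta t$. *Cell averages.* Let $\alpha_{i+\frac12}>0$ be an upper bound for the maximum (absolute) wave speed of the Riemann problem with left and right data $\overline{\boldsymbol U}_i,\overline{\boldsymbol U}_{i+1}$. Define $$\widehat{\boldsymbol F}^{L}_{i+\frac12}=\tfrac12\left(\boldsymbol F(\overline{\boldsymbol U}_i)+\boldsymbol F(\overline{\boldsymbol U}_{i+1})\right)-\tfrac{\alpha_{i+\frac12}}2\left(\overline{\boldsymbol U}_{i+1}-\overline{\boldsymbol U}_i\right),\quad \widehat{\boldsymbol F}^{H}_{i+\frac12}=\boldsymbol F(\boldsymbol U_{i+\frac12}),\quad \Delta\widehat{\boldsymbol F}_{i+\frac12}=\widehat{\boldsymbol F}^{H}_{i+\frac12}-\widehat{\boldsymbol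 F}^{L}_{i+\frac12},$$ $$\widetilde{\boldsymbol U}_{i+\frac12}=\tfrac12\left(\overline{\boldsymbol U}_i+\overline{\boldsymbol U}_{i+1}\right)+\tfrac1{2\alpha_{i+\frac12}}\left[\boldsymbol F(\overline{\boldsymbol U}_i)-\boldsymbol F(\overline{\boldsymbol U}_{i+1})\right].$$ The new cell average is $\overline{\boldsymbol U}_i-\frac{\Delta t}{\Delta x_i}\left(\widehat{\boldsymbol F}^{Lim}_{i+\frac12}-\widehat{\boldsymbol F}^{Lim}_{i-\frac12}\right)$, with $\widehat{\boldsymbol F}^{Lim}$ as follows (the index $i+\frac12$ is suppressed where all quantities carry it). - Scalar case: $\hat f^{Lim}=\hat f^{L}+\Delta\hat f^{Lim}$, where $\Delta\hat f^{Lim}$ is given by one of two choices. Global maximum principle: $\Delta\hat f^{Lim}=\min\{\Delta\hat f,\alpha(\tilde u-m_0),\alpha(M_0-\tilde u)\}$ if $\Delta\hat f\ge0$, and $\Delta\hat f^{Lim}=\max\{\Delta\hat f,\alpha(m_0-\tilde u),\alpha(\tilde u-M_0)\}$ otherwise. Local maximum principle: $\Delta\hat f^{Lim}_{i+\frac12}=\min\{\Delta\hat f_{i+\frac12},\alpha_{i+\frac12}(\tilde u_{i+\frac12}-u_i^{\min}),\alpha_{i+\frac12}(u_{i+1}^{\max}-\tilde u_{i+\frac12})\}$ if $\Delta\hat f_{i+\frac12}\ge0$, and $\max\{\Delta\hat f_{i+\frac12},\alpha_{i+\frac12}(u_{i+1}^{\min}-\tilde u_{i+\frac12}),\alpha_{i+\frac12}(\tilde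 u_{i+\frac12}-u_i^{\max})\}$ otherwise, with $u_i^{\min}=\min\{\bar u_i,\tilde u_{i-\frac12},\tilde u_{i+\frac12}\}$, $u_i^{\max}=\max\{\bar u_i,\tilde u_{i-\frac12},\tilde u_{i+\frac12}\}$. - Euler case: put $\bar\varepsilon^\rho=\min\{10^{-13},\widetilde{\boldsymbol U}^\rho\}$ and $\bar\varepsilon^p=\min\{10^{-13},p(\widetilde{\boldsymbol U})\}$. Let $\Delta\widehat{\boldsymbol F}^{Lim,*}$ have density component $\min\{\Delta\widehat{\boldsymbol F}^\rho,\alpha(\widetilde{\boldsymbol U}^\rho-\bar\varepsilon^\rho)\}$ if $\Delta\widehat{\boldsymbol F}^\rho\ge0$ and $\max\{\Delta\widehat{\boldsymbol F}^\rho,\alpha(\bar\varepsilon^\rho-\widetilde{\boldsymbol U}^\rho)\}$ otherwise, and its other components equal to those of $\Delta\widehat{\boldsymbol F}$. Writing $\boldsymbol D=\Delta\widehat{\boldsymbol F}^{Lim,*}$ and $\tilde\varepsilon=\bar\varepsilon^p/(\gamma-1)$, set $$A=\tfrac12(\boldsymbol D^{\rho v})^2-\boldsymbol D^\rho\boldsymbol D^E,\quad B=\alpha\left(\boldsymbol D^\rho\widetilde{\boldsymbol U}^E+\widetilde{\boldsymbol U}^\rho\boldsymbol D^E-\boldsymbol D^{\rho v}\widetilde{\boldsymbol U}^{\rho v}-\tilde\varepsilon\boldsymbol D^\rho\right),$$ $$C=\alpha^2\left(\widetilde{\boldsymbol U}^\rho\widetilde{\boldsymbol U}^E-\tfrac12(\widetilde{\boldsymbol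 U}^{\rho v})^2-\tilde\varepsilon\widetilde{\boldsymbol U}^\rho\right),\quad \theta=\min\left\{1,\frac{C}{\max\{0,A\}+|B|}\right\}$$ ($\theta=1$ if the denominator vanishes), and $\widehat{\boldsymbol F}^{Lim}=\widehat{\boldsymbol F}^{L}+\theta\,\Delta\widehat{\boldsymbol F}^{Lim,*}$. *Point values.* Let $\boldsymbol U^H_{i+\frac12}=\boldsymbol U_{i+\frac12}-\Delta t\,\boldsymbol{\mathcal R}(\dots)$ be the unlimited forward-Euler update. Let $\alpha_i=\max\{\lambda(\boldsymbol U_{i-\frac12}),\lambda(\boldsymbol U_{i+\frac12})\}$, where $\lambda(\boldsymbol U)$ is the largest absolute value of an eigenvalue of $\partial\boldsymbol F/\partial\boldsymbol U$ at $\boldsymbol U$, and $$\boldsymbol U^L_{i+\frac12}=\boldsymbol U_{i+\frac12}-\frac{2\Delta t}{\Delta x_i+\Delta x_{i+1}}\left(\boldsymbol G_{i+1}-\boldsymbol G_i\right),\quad \boldsymbol G_i=\tfrac12\left(\boldsymbol F(\boldsymbol U_{i-\frac12})+\boldsymbol F(\boldsymbol U_{i+\frac12})\right)-\tfrac{\alpha_i}2\left(\boldsymbol U_{i+\frac12}-\boldsymbol U_{i-\frac12}\right).$$ The new point value is $\boldsymbol U^{Lim}_{i+\frac12}$, defined as follows (index $i+\frac12$ suppressed). - Scalar case: $u^{Lim}=\theta u^H+(1-\theta)u^L$, with $\theta=\frac{u^L-m_0}{u^L-u^H}$ if $u^H<m_0$, $\theta=\frac{M_0-u^L}{u^H-u^L}$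 if $u^H>M_0$, and $\theta=1$ otherwise. - Euler case: let $\varepsilon^\rho=\min\{10^{-13},\boldsymbol U^{L,\rho}\}$ and $\varepsilon^p=\min\{10^{-13},p(\boldsymbol U^L)\}$. Let $\theta^*=\frac{\boldsymbol U^{L,\rho}-\varepsilon^\rho}{\boldsymbol U^{L,\rho}-\boldsymbol U^{H,\rho}}$ if $\boldsymbol U^{H,\rho}<\varepsilon^\rho$ and $\theta^*=1$ otherwise. Let $\boldsymbol U^{Lim,*}$ have density component $\theta^*\boldsymbol U^{H,\rho}+(1-\theta^* )\boldsymbol U^{L,\rho}$ and its other components equal to those of $\boldsymbol U^H$. Let $\theta^{**}=\frac{p(\boldsymbol U^L)-\varepsilon^p}{p(\boldsymbol U^L)-p(\boldsymbol U^{Lim,*})}$ if $p(\boldsymbol U^{Lim,*})<\varepsilon^p$ and $\theta^{**}=1$ otherwise. Then $\boldsymbol U^{Lim}=\theta^{**}\boldsymbol U^{Lim,*}+(1-\theta^{**})\boldsymbol U^L$.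
   Formalization: In the scalar case, if f is neither convex nor concave on [m_0,M_0], it is additionally assumed that u^L ≠ u^H whenever u^H lies outside [m_0,M_0], in every stage; otherwise the limiter's θ is undefined and the claim can fail (e.g. f = -sin u). *)

theory Defs
  imports "HOL-Analysis.Analysis"
begin

section \<open>Riemann problems and wave speeds\<close>

text \<open>
  The largest absolute value of an eigenvalue of the Jacobian of \<open>F\<close> at \<open>U\<close>.  The systems considered
  here are hyperbolic, so only real eigenvalues occur.
\<close>

definition max_char_speed :: "('a::real_normed_vector \<Rightarrow> 'a) \<Rightarrow> 'a \<Rightarrow> real" where
  "max_char_speed F U =
     Sup {\<bar>\<mu>\<bar> | \<mu>. \<exists>r. r \<noteq> 0 \<and> frechet_derivative F (at U) r = \<mu> *\<^sub>R r}"

text \<open>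
  A continuously differentiable, compactly supported test function of \<open>(x, t)\<close>, together with its
  partial derivatives.  Points with \<open>t \<le> 0\<close> may lie in the support, so the restrictions to
  \<open>t \<ge> 0\<close> need not vanish at \<open>t = 0\<close>.
\<close>

definition test_function ::
  "(real \<times> real \<Rightarrow> real) \<Rightarrow> (real \<times> real \<Rightarrow> real) \<Rightarrow> (real \<times> real \<Rightarrow> real) \<Rightarrow> bool" where
  "test_function \<phi> \<phi>x \<phi>t \<longleftrightarrow>
     continuous_on UNIV \<phi>x \<and> continuous_on UNIV \<phi>t \<and>
     (\<forall>x t. ((\<lambda>y. \<phi> (y, t)) has_real_derivative \<phi>x (x, t)) (at x)) \<and>
     (\<forall>x t. ((\<lambda>s. \<phi> (x, s)) has_real_derivative \<phi>t (x, t)) (at t)) \<and>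
     (\<exists>r. \<forall>z. r < norm z \<longrightarrow> \<phi> z = 0)"

text \<open>
  The weak form of \<open>\<partial>\<^sub>t u + \<partial>\<^sub>x g\<close> on \<open>t > 0\<close>, tested with \<open>\<phi>\<close>, for the self-similar functions
  \<open>u (x / t)\<close> and \<open>g (x / t)\<close> and the initial data \<open>uL\<close> for \<open>x < 0\<close>, \<open>uR\<close> for \<open>x \<ge> 0\<close>.
\<close>

definition weak_form ::
  "(real \<times> real \<Rightarrow> real) \<Rightarrow> (real \<times> real \<Rightarrow> real) \<Rightarrow> (real \<times> real \<Rightarrow> real) \<Rightarrow>
   (real \<Rightarrow> 'b::euclidean_space) \<Rightarrow> (real \<Rightarrow> 'b) \<Rightarrow> 'b \<Rightarrow> 'b \<Rightarrow> 'b" where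
  "weak_form \<phi> \<phi>x \<phi>t u g uL uR =
     set_lebesgue_integral lborel {z. 0 < snd z}
       (\<lambda>z. \<phi>t z *\<^sub>R u (fst z / snd z) + \<phi>x z *\<^sub>R g (fst z / snd z)) +
     integral\<^sup>L lborel (\<lambda>x. \<phi> (x, 0) *\<^sub>R (if x < 0 then uL else uR))"

definition bdd_measurable :: "(real \<Rightarrow> 'b::euclidean_space) \<Rightarrow> bool" where
  "bdd_measurable g \<longleftrightarrow> g \<in> borel_measurable borel \<and> bounded (range g)"

text \<open>
  \<open>W (x / t)\<close> is a self-similar weak entropy solution of the Riemann problem with data \<open>UL\<close>, \<open>UR\<close>.
  Its values lie in the set \<open>S\<close> of states, and \<open>P\<close> is the set of entropy/entropy-flux pairs whose
  entropy inequality is imposed.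
\<close>

definition riemann_solution ::
  "('a::euclidean_space \<Rightarrow> 'a) \<Rightarrow> 'a set \<Rightarrow> (('a \<Rightarrow> real) \<times> ('a \<Rightarrow> real)) set \<Rightarrow>
   'a \<Rightarrow> 'a \<Rightarrow> (real \<Rightarrow> 'a) \<Rightarrow> bool" where
  "riemann_solution F S P UL UR W \<longleftrightarrow>
     range W \<subseteq> S \<and> bdd_measurable W \<and> bdd_measurable (F \<circ> W) \<and>
     (\<forall>\<phi> \<phi>x \<phi>t. test_function \<phi> \<phi>x \<phi>t \<longrightarrow> weak_form \<phi> \<phi>x \<phi>t W (F \<circ> W) UL UR = 0) \<and>
     (\<forall>(\<eta>, q) \<in> P. bdd_measurable (\<eta> \<circ> W) \<and> bdd_measurable (q \<circ> W) \<and>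
        (\<forall>\<phi> \<phi>x \<phi>t. test_function \<phi> \<phi>x \<phi>t \<and> (\<forall>z. 0 \<le> \<phi> z) \<longrightarrow>
           0 \<le> weak_form \<phi> \<phi>x \<phi>t (\<eta> \<circ> W) (q \<circ> W) (\<eta> UL) (\<eta> UR)))"

text \<open>
  All waves of the Riemann solution have absolute speed at most \<open>a\<close>, i.e. the solution is still
  undisturbed for \<open>\<bar>x\<bar> > a t\<close>.
\<close>

definition riemann_speed_bound ::
  "('a::euclidean_space \<Rightarrow> 'a) \<Rightarrow> 'a set \<Rightarrow> (('a \<Rightarrow> real) \<times> ('a \<Rightarrow> real)) set \<Rightarrow>
   'a \<Rightarrow> 'a \<Rightarrow> real \<Rightarrow> bool" where
  "riemann_speed_bound F S P UL UR a \<longleftrightarrow>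
     (\<exists>W. riemann_solution F S P UL UR W \<and> (\<forall>\<xi> < - a. W \<xi> = UL) \<and> (\<forall>\<xi> > a. W \<xi> = UR))"


section \<open>The limited active flux scheme\<close>

text \<open>
  \<open>avg V i\<close> belongs to the cell \<open>i\<close> and \<open>pnt V i\<close> to the interface \<open>i + 1/2\<close>.  In general, a quantity
  located at the interface \<open>i + 1/2\<close> carries the index \<open>i\<close>.
\<close>

record 'a af_data =
  avg :: "int \<Rightarrow> 'a"
  pnt :: "int \<Rightarrow> 'a"

definition llf_flux :: "('a::real_vector \<Rightarrow> 'a) \<Rightarrow> real \<Rightarrow> 'a \<Rightarrow> 'a \<Rightarrow> 'a" where
  "llf_flux F a UL UR = (1/2) *\<^sub>R (F UL + F UR) - (a/2) *\<^sub>R (UR - UL)"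

text \<open>The data \<open>\<alpha>\<close> below are the speeds \<open>\<alpha>\<close> at the interfaces \<open>i + 1/2\<close>.\<close>

definition flux_low :: "('a::real_vector \<Rightarrow> 'a) \<Rightarrow> (int \<Rightarrow> real) \<Rightarrow> 'a af_data \<Rightarrow> int \<Rightarrow> 'a" where
  "flux_low F \<alpha> V i = llf_flux F (\<alpha> i) (avg V i) (avg V (i + 1))"

definition flux_diff :: "('a::real_vector \<Rightarrow> 'a) \<Rightarrow> (int \<Rightarrow> real) \<Rightarrow> 'a af_data \<Rightarrow> int \<Rightarrow> 'a" where
  "flux_diff F \<alpha> V i = F (pnt V i) - flux_low F \<alpha> V i"

definition U_tilde :: "('a::real_vector \<Rightarrow> 'a) \<Rightarrow> (int \<Rightarrow> real) \<Rightarrow> 'a af_data \<Rightarrow> int \<Rightarrow> 'a" where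
  "U_tilde F \<alpha> V i =
     (1/2) *\<^sub>R (avg V i + avg V (i + 1)) + (1 / (2 * \<alpha> i)) *\<^sub>R (F (avg V i) - F (avg V (i + 1)))"

definition cell_speed :: "('a::real_normed_vector \<Rightarrow> 'a) \<Rightarrow> 'a af_data \<Rightarrow> int \<Rightarrow> real" where
  "cell_speed F V i = max (max_char_speed F (pnt V (i - 1))) (max_char_speed F (pnt V i))"

definition point_flux :: "('a::real_normed_vector \<Rightarrow> 'a) \<Rightarrow> 'a af_data \<Rightarrow> int \<Rightarrow> 'a" where
  "point_flux F V i = llf_flux F (cell_speed F V i) (pnt V (i - 1)) (pnt V i)"

definition point_low ::
  "('a::real_normed_vector \<Rightarrow> 'a) \<Rightarrow> (int \<Rightarrow> real) \<Rightarrow> real \<Rightarrow> 'a af_data \<Rightarrow> int \<Rightarrow> 'a" where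
  "point_low F dx dt V i =
     pnt V i - (2 * dt / (dx i + dx (i + 1))) *\<^sub>R (point_flux F V (i + 1) - point_flux F V i)"

text \<open>
  The operator \<open>R i\<close> approximates \<open>\<partial>\<^sub>x F\<close> at the interface \<open>i + 1/2\<close>; it receives the list of point
  values and the list of cell averages in the stencil.  It may depend on \<open>i\<close> through the mesh.
\<close>

definition residual ::
  "nat \<Rightarrow> nat \<Rightarrow> (int \<Rightarrow> 'a list \<Rightarrow> 'a list \<Rightarrow> 'a) \<Rightarrow> 'a af_data \<Rightarrow> int \<Rightarrow> 'a" where
  "residual l1 l2 R V i =
     R i (map (pnt V) [i - int l1..i + int l2]) (map (avg V) [i + 1 - int l1..i + int l2])"

definition point_high ::
  "nat \<Rightarrow> nat \<Rightarrow> (int \<Rightarrow> 'a list \<Rightarrow> 'a list \<Rightarrow> 'a::real_vector) \<Rightarrow> real \<Rightarrow> 'a af_data \<Rightarrow> int \<Rightarrow> 'a" where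
  "point_high l1 l2 R dt V i = pnt V i - dt *\<^sub>R residual l1 l2 R V i"

text \<open>
  One limited forward Euler step.  \<open>corr \<alpha> V i\<close> is the limited flux correction, which is added to the
  low-order flux, and \<open>plim UL UH\<close> is the limited point value.
\<close>

definition limited_euler_step ::
  "('a::real_normed_vector \<Rightarrow> 'a) \<Rightarrow> (int \<Rightarrow> real) \<Rightarrow>
   nat \<Rightarrow> nat \<Rightarrow> (int \<Rightarrow> 'a list \<Rightarrow> 'a list \<Rightarrow> 'a) \<Rightarrow>
   ((int \<Rightarrow> real) \<Rightarrow> 'a af_data \<Rightarrow> int \<Rightarrow> 'a) \<Rightarrow> ('a \<Rightarrow> 'a \<Rightarrow> 'a) \<Rightarrow>
   real \<Rightarrow> (int \<Rightarrow> real) \<Rightarrow> 'a af_data \<Rightarrow> 'a af_data" where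
  "limited_euler_step F dx l1 l2 R corr plim dt \<alpha> V =
     \<lparr> avg = (\<lambda>i. avg V i - (dt / dx i) *\<^sub>R
                 ((flux_low F \<alpha> V i + corr \<alpha> V i) - (flux_low F \<alpha> V (i - 1) + corr \<alpha> V (i - 1)))),
       pnt = (\<lambda>i. plim (point_low F dx dt V i) (point_high l1 l2 R dt V i)) \<rparr>"

definition af_comb :: "real \<Rightarrow> 'a::real_vector af_data \<Rightarrow> real \<Rightarrow> 'a af_data \<Rightarrow> 'a af_data" where
  "af_comb a V b W =
     \<lparr> avg = (\<lambda>i. a *\<^sub>R avg V i + b *\<^sub>R avg W i),
       pnt = (\<lambda>i. a *\<^sub>R pnt V i + b *\<^sub>R pnt W i) \<rparr>"

text \<open>
  \<open>E k\<close> is the forward Euler step of stage \<open>k = 0, 1, 2\<close> (the stages may use different speeds \<open>\<alpha>\<close>) and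
  \<open>rk_stage E V k\<close> is the data entering it.
\<close>

fun rk_stage :: "(nat \<Rightarrow> 'a::real_vector af_data \<Rightarrow> 'a af_data) \<Rightarrow> 'a af_data \<Rightarrow> nat \<Rightarrow> 'a af_data" where
  "rk_stage E V 0 = V"
| "rk_stage E V (Suc 0) = E 0 V"
| "rk_stage E V (Suc (Suc _)) = af_comb (3/4) V (1/4) (E 1 (E 0 V))"

definition ssp_rk3 :: "(nat \<Rightarrow> 'a::real_vector af_data \<Rightarrow> 'a af_data) \<Rightarrow> 'a af_data \<Rightarrow> 'a af_data" where
  "ssp_rk3 E V = af_comb (1/3) V (2/3) (E 2 (rk_stage E V 2))"

text \<open>
  The second bound is \<open>dt \<le> (dx i + dx (i + 1)) / (4 max)\<close>, multiplied out because the maximum may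
  vanish for a scalar law, in which case there is no restriction.
\<close>

definition cfl ::
  "('a::real_normed_vector \<Rightarrow> 'a) \<Rightarrow> (int \<Rightarrow> real) \<Rightarrow> real \<Rightarrow> (int \<Rightarrow> real) \<Rightarrow> 'a af_data \<Rightarrow> bool" where
  "cfl F dx dt \<alpha> V \<longleftrightarrow>
     (\<forall>i. dt \<le> dx i / (\<alpha> (i - 1) + \<alpha> i) \<and>
          dt * (4 * max (cell_speed F V i) (cell_speed F V (i + 1))) \<le> dx i + dx (i + 1))"

definition speeds_valid ::
  "('a::euclidean_space \<Rightarrow> 'a) \<Rightarrow> 'a set \<Rightarrow> (('a \<Rightarrow> real) \<times> ('a \<Rightarrow> real)) set \<Rightarrow>
   (int \<Rightarrow> real) \<Rightarrow> 'a af_data \<Rightarrow> bool" where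
  "speeds_valid F S P \<alpha> V \<longleftrightarrow>
     (\<forall>i. 0 < \<alpha> i \<and> riemann_speed_bound F S P (avg V i) (avg V (i + 1)) (\<alpha> i))"


section \<open>Scalar conservation laws\<close>

definition kruzhkov_pairs :: "(real \<Rightarrow> real) \<Rightarrow> ((real \<Rightarrow> real) \<times> (real \<Rightarrow> real)) set" where
  "kruzhkov_pairs f = range (\<lambda>k. (\<lambda>u. \<bar>u - k\<bar>, \<lambda>u. sgn (u - k) * (f u - f k)))"

definition global_correction ::
  "(real \<Rightarrow> real) \<Rightarrow> real \<Rightarrow> real \<Rightarrow> (int \<Rightarrow> real) \<Rightarrow> real af_data \<Rightarrow> int \<Rightarrow> real" where
  "global_correction f m0 M0 \<alpha> V i =
     (let d = flux_diff f \<alpha> V i; u = U_tilde f \<alpha> V i in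
      if 0 \<le> d then Min {d, \<alpha> i * (u - m0), \<alpha> i * (M0 - u)}
      else Max {d, \<alpha> i * (m0 - u), \<alpha> i * (u - M0)})"

definition local_min :: "(real \<Rightarrow> real) \<Rightarrow> (int \<Rightarrow> real) \<Rightarrow> real af_data \<Rightarrow> int \<Rightarrow> real" where
  "local_min f \<alpha> V i = Min {avg V i, U_tilde f \<alpha> V (i - 1), U_tilde f \<alpha> V i}"

definition local_max :: "(real \<Rightarrow> real) \<Rightarrow> (int \<Rightarrow> real) \<Rightarrow> real af_data \<Rightarrow> int \<Rightarrow> real" where
  "local_max f \<alpha> V i = Max {avg V i, U_tilde f \<alpha> V (i - 1), U_tilde f \<alpha> V i}"

definition local_correction ::
  "(real \<Rightarrow> real) \<Rightarrow> (int \<Rightarrow> real) \<Rightarrow> real af_data \<Rightarrow> int \<Rightarrow> real" where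
  "local_correction f \<alpha> V i =
     (let d = flux_diff f \<alpha> V i; u = U_tilde f \<alpha> V i in
      if 0 \<le> d
      then Min {d, \<alpha> i * (u - local_min f \<alpha> V i), \<alpha> i * (local_max f \<alpha> V (i + 1) - u)}
      else Max {d, \<alpha> i * (local_min f \<alpha> V (i + 1) - u), \<alpha> i * (u - local_max f \<alpha> V i)})"

datatype max_principle = Global | Local

definition scalar_correction ::
  "max_principle \<Rightarrow> (real \<Rightarrow> real) \<Rightarrow> real \<Rightarrow> real \<Rightarrow> (int \<Rightarrow> real) \<Rightarrow> real af_data \<Rightarrow> int \<Rightarrow> real" where
  "scalar_correction mp f m0 M0 =
     (case mp of Global \<Rightarrow> global_correction f m0 M0 | Local \<Rightarrow> local_correction f)"

definition scalar_point_lim :: "real \<Rightarrow> real \<Rightarrow> real \<Rightarrow> real \<Rightarrow> real" where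
  "scalar_point_lim m0 M0 uL uH =
     (let \<theta> = (if uH < m0 then (uL - m0) / (uL - uH)
               else if M0 < uH then (M0 - uL) / (uH - uL)
               else 1)
      in \<theta> * uH + (1 - \<theta>) * uL)"

text \<open>
  The quotients in the definition of \<open>scalar_point_lim\<close> have nonzero denominators.  For convex or
  concave \<open>f\<close> this is a consequence of the time step restriction.  It may fail for other \<open>f\<close>, because
  \<open>\<alpha>\<^sub>i\<close> is computed from \<open>f'\<close> at the two interfaces only and need not bound \<open>f'\<close> between the two
  point values.
\<close>

definition scalar_point_lim_defined :: "real \<Rightarrow> real \<Rightarrow> real \<Rightarrow> real \<Rightarrow> bool" where
  "scalar_point_lim_defined m0 M0 uL uH \<longleftrightarrow> (uH < m0 \<or> M0 < uH \<longrightarrow> uL \<noteq> uH)"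

definition scalar_step ::
  "(real \<Rightarrow> real) \<Rightarrow> real \<Rightarrow> real \<Rightarrow> max_principle \<Rightarrow> (int \<Rightarrow> real) \<Rightarrow>
   nat \<Rightarrow> nat \<Rightarrow> (int \<Rightarrow> real list \<Rightarrow> real list \<Rightarrow> real) \<Rightarrow>
   real \<Rightarrow> (int \<Rightarrow> real) \<Rightarrow> real af_data \<Rightarrow> real af_data" where
  "scalar_step f m0 M0 mp dx l1 l2 R =
     limited_euler_step f dx l1 l2 R (scalar_correction mp f m0 M0) (scalar_point_lim m0 M0)"


section \<open>The Euler equations for a perfect gas\<close>

text \<open>The components 1, 2, 3 of a state are density, momentum and total energy.\<close>

definition pressure :: "real \<Rightarrow> real^3 \<Rightarrow> real" where
  "pressure \<gamma> U = (\<gamma> - 1) * (U$3 - (U$2)\<^sup>2 / (2 * U$1))"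

definition euler_flux :: "real \<Rightarrow> real^3 \<Rightarrow> real^3" where
  "euler_flux \<gamma> U =
     (let v = U$2 / U$1; p = pressure \<gamma> U in vector [U$2, U$1 * v\<^sup>2 + p, (U$3 + p) * v])"

definition euler_G :: "real \<Rightarrow> (real^3) set" where
  "euler_G \<gamma> = {U. 0 < U$1 \<and> 0 < pressure \<gamma> U}"

text \<open>
  The solution of a Riemann problem may contain vacuum, which is represented by the zero state; the
  flux and the entropy pair below vanish there.
\<close>

definition euler_states :: "real \<Rightarrow> (real^3) set" where
  "euler_states \<gamma> = insert 0 (euler_G \<gamma>)"

definition euler_entropy_pair :: "real \<Rightarrow> ((real^3 \<Rightarrow> real) \<times> (real^3 \<Rightarrow> real)) set" where
  "euler_entropy_pair \<gamma> =
     {(\<lambda>U. - (U$1) * ln (pressure \<gamma> U / (U$1) powr \<gamma>),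
       \<lambda>U. - (U$2) * ln (pressure \<gamma> U / (U$1) powr \<gamma>))}"

definition set_density :: "real \<Rightarrow> real^3 \<Rightarrow> real^3" where
  "set_density d U = vector [d, U$2, U$3]"

definition euler_correction_star ::
  "real \<Rightarrow> (int \<Rightarrow> real) \<Rightarrow> (real^3) af_data \<Rightarrow> int \<Rightarrow> real^3" where
  "euler_correction_star \<gamma> \<alpha> V i =
     (let D = flux_diff (euler_flux \<gamma>) \<alpha> V i;
          U = U_tilde (euler_flux \<gamma>) \<alpha> V i;
          \<epsilon> = min (1 / 10^13) (U$1)
      in set_density (if 0 \<le> D$1 then min (D$1) (\<alpha> i * (U$1 - \<epsilon>))
                      else max (D$1) (\<alpha> i * (\<epsilon> - U$1))) D)"

definition euler_theta :: "real \<Rightarrow> (int \<Rightarrow> real) \<Rightarrow> (real^3) af_data \<Rightarrow> int \<Rightarrow> real" where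
  "euler_theta \<gamma> \<alpha> V i =
     (let D = euler_correction_star \<gamma> \<alpha> V i;
          U = U_tilde (euler_flux \<gamma>) \<alpha> V i;
          \<epsilon> = min (1 / 10^13) (pressure \<gamma> U) / (\<gamma> - 1);
          A = (1/2) * (D$2)\<^sup>2 - D$1 * D$3;
          B = \<alpha> i * (D$1 * U$3 + U$1 * D$3 - D$2 * U$2 - \<epsilon> * D$1);
          C = (\<alpha> i)\<^sup>2 * (U$1 * U$3 - (1/2) * (U$2)\<^sup>2 - \<epsilon> * U$1);
          d = max 0 A + \<bar>B\<bar>
      in if d = 0 then 1 else min 1 (C / d))"

definition euler_correction ::
  "real \<Rightarrow> (int \<Rightarrow> real) \<Rightarrow> (real^3) af_data \<Rightarrow> int \<Rightarrow> real^3" where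
  "euler_correction \<gamma> \<alpha> V i = euler_theta \<gamma> \<alpha> V i *\<^sub>R euler_correction_star \<gamma> \<alpha> V i"

definition euler_point_lim :: "real \<Rightarrow> real^3 \<Rightarrow> real^3 \<Rightarrow> real^3" where
  "euler_point_lim \<gamma> UL UH =
     (let er = min (1 / 10^13) (UL$1);
          ep = min (1 / 10^13) (pressure \<gamma> UL);
          \<theta>1 = (if UH$1 < er then (UL$1 - er) / (UL$1 - UH$1) else 1);
          U = set_density (\<theta>1 * UH$1 + (1 - \<theta>1) * UL$1) UH;
          \<theta>2 = (if pressure \<gamma> U < ep
                then (pressure \<gamma> UL - ep) / (pressure \<gamma> UL - pressure \<gamma> U) else 1)
      in \<theta>2 *\<^sub>R U + (1 - \<theta>2) *\<^sub>R UL)"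

definition euler_step ::
  "real \<Rightarrow> (int \<Rightarrow> real) \<Rightarrow>
   nat \<Rightarrow> nat \<Rightarrow> (int \<Rightarrow> (real^3) list \<Rightarrow> (real^3) list \<Rightarrow> real^3) \<Rightarrow>
   real \<Rightarrow> (int \<Rightarrow> real) \<Rightarrow> (real^3) af_data \<Rightarrow> (real^3) af_data" where
  "euler_step \<gamma> dx l1 l2 R =
     limited_euler_step (euler_flux \<gamma>) dx l1 l2 R (euler_correction \<gamma>) (euler_point_lim \<gamma>)"

end

theory Submission
  imports Defs
begin

text \<open>
  Both parts say that the data stay in a convex set \<open>G\<close>: the interval \<open>[m0, M0]\<close>, or the states of positive
  density and pressure.  An SSP-RK3 step consists of convex combinations of forward Euler steps, so it
  suffices that one limited Euler step maps \<open>G\<close> into itself (\<open>scalar_step_in\<close>, \<open>euler_step_in\<close>).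

  Cell averages.  Let \<open>U\<close> be the intermediate state of the low-order flux at an interface.  The new average is a
  convex combination of the old one and of the states \<open>U - c / \<alpha>\<close> and \<open>U + c / \<alpha>\<close> at the right and the left
  interface, \<open>c\<close> being the limited flux correction (\<open>limited_avg_in_convex\<close>).  The limiters are tuned so that
  these states belong to \<open>G\<close> as soon as \<open>U\<close> does (\<open>scalar_correction_bounds\<close>, \<open>euler_correction_in_G\<close>).
  That \<open>U\<close> belongs to \<open>G\<close> is where the wave speed bound enters: \<open>U\<close> is the mean of the Riemann solution \<open>W\<close>
  over \<open>[- \<alpha>, \<alpha>]\<close>.  This is extracted from the weak formulation with test functions \<open>\<theta> (x / t) * \<psi> t\<close>, for
  which it collapses to one integral over \<open>\<xi> = x / t\<close>.  In the scalar case the Kruzhkov inequalities with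
  the constants \<open>m0\<close> and \<open>M0\<close> then bound \<open>U\<close> directly (\<open>scalar_lf_state_between\<close>).  In the Euler case the
  values of \<open>W\<close> are admissible or vacuum, so the mean is admissible unless \<open>W\<close> is almost everywhere vacuum
  in the fan, and the jump condition at the edge of the fan excludes that (\<open>euler_lf_state_in_G\<close>).

  Point values.  The scalar limiter returns \<open>m0\<close>, \<open>M0\<close> or an admissible high-order value; one only has to
  know that its quotients are defined, which for convex or concave fluxes follows from the low-order
  value lying in the interval (\<open>scalar_point_low_between\<close>).  The Euler limiter interpolates between the high-order
  and the low-order value and relies on the concavity of the pressure.  The low-order value is admissible
  because \<open>a U + F U\<close> and \<open>a U - F U\<close> are, whenever \<open>a\<close> is at least the largest characteristic speed
  (\<open>euler_flux_splitting\<close>).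

  The nonlinear Euler set becomes tractable by writing it as an intersection of half spaces: besides
  positive density, the energy has to be positive in every moving frame (\<open>euler_G_iff\<close>).
\<close>

section \<open>Smooth cutoff functions\<close>

definition ramp_square :: "real \<Rightarrow> real" where
  "ramp_square y = (max 0 y)\<^sup>2"

lemma DERIV_ramp_square [derivative_intros]:
  assumes "(f has_real_derivative f') (at x within S)"
  shows "((\<lambda>x. ramp_square (f x)) has_real_derivative 2 * max 0 (f x) * f') (at x within S)"
proof -
  have main: "(ramp_square has_real_derivative 2 * max 0 y) (at y)" for y :: real
  proof -
    consider "y > 0" | "y < 0" | "y = 0" by linarith
    then show ?thesis
    proof cases
      case 1
      have "((\<lambda>y. y\<^sup>2) has_real_derivative 2 * max 0 y) (at y)"
        using 1 by (auto intro!: derivative_eq_intros)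
      then show ?thesis
        by (rule has_field_derivative_transform_within_open[where S = "{0<..}"])
           (use 1 in \<open>auto simp: ramp_square_def\<close>)
    next
      case 2
      have "((\<lambda>y. 0) has_real_derivative 2 * max 0 y) (at y)" using 2 by simp
      then show ?thesis
        by (rule has_field_derivative_transform_within_open[where S = "{..<0}"])
           (use 2 in \<open>auto simp: ramp_square_def\<close>)
    next
      case 3
      have "((\<lambda>h::real. max 0 h) \<longlongrightarrow> max 0 0) (at 0)"
        by (intro tendsto_intros)
      moreover have "\<forall>\<^sub>F h in at 0. max 0 h = (ramp_square (0 + h) - ramp_square 0) / h"
        by (auto simp: eventually_at_filter ramp_square_def max_def power2_eq_square)
      ultimately have "((\<lambda>h. (ramp_square (0 + h) - ramp_square 0) / h) \<longlongrightarrow> max 0 0) (at 0)"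
        by (rule Lim_transform_eventually)
      then show ?thesis using 3 by (simp add: DERIV_def)
    qed
  qed
  show ?thesis using DERIV_chain2[OF main assms] by simp
qed

lemma continuous_on_ramp_square [continuous_intros]:
  "continuous_on S f \<Longrightarrow> continuous_on S (\<lambda>x. ramp_square (f x))"
  unfolding ramp_square_def by (intro continuous_intros)

text \<open>
  A test function for the weak formulation has to be built together with its derivative, because
  \<open>test_function\<close> names the partial derivatives; hence \<open>\<theta>\<close> and \<open>\<theta>'\<close> form a pair.
\<close>

definition bump :: "(real \<Rightarrow> real) \<Rightarrow> (real \<Rightarrow> real) \<Rightarrow> real \<Rightarrow> real \<Rightarrow> bool" where
  "bump \<theta> \<theta>' l u \<longleftrightarrow>
     (\<forall>x. (\<theta> has_real_derivative \<theta>' x) (at x)) \<and> continuous_on UNIV \<theta>' \<and>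
     (\<forall>x. x \<notin> {l<..<u} \<longrightarrow> \<theta> x = 0 \<and> \<theta>' x = 0)"

lemma bump_continuous: "bump \<theta> \<theta>' l u \<Longrightarrow> continuous_on UNIV \<theta>"
  unfolding bump_def by (meson DERIV_continuous_on DERIV_subset UNIV_I top_greatest)

text \<open>
  A cutoff that equals 1 on \<open>[c, b]\<close> and falls to 0 within distance \<open>r\<close>.  Squaring the positive part
  twice makes it continuously differentiable, which is all the smoothness that test functions need.
\<close>

definition plateau :: "real \<Rightarrow> real \<Rightarrow> real \<Rightarrow> real \<Rightarrow> real" where
  "plateau c b r x = ramp_square (1 - (ramp_square (x - b) + ramp_square (c - x)) / r\<^sup>2)"

definition plateau_deriv :: "real \<Rightarrow> real \<Rightarrow> real \<Rightarrow> real \<Rightarrow> real" where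
  "plateau_deriv c b r x =
     2 * max 0 (1 - (ramp_square (x - b) + ramp_square (c - x)) / r\<^sup>2) *
     ((2 * max 0 (c - x) - 2 * max 0 (x - b)) / r\<^sup>2)"

lemma plateau_nonneg: "0 \<le> plateau c b r x"
  by (simp add: plateau_def ramp_square_def)

lemma plateau_eq_1: "c \<le> x \<Longrightarrow> x \<le> b \<Longrightarrow> plateau c b r x = 1"
  by (simp add: plateau_def ramp_square_def)

lemma plateau_deriv_eq_0: "c \<le> x \<Longrightarrow> x \<le> b \<Longrightarrow> plateau_deriv c b r x = 0"
  by (simp add: plateau_deriv_def ramp_square_def)

lemma bump_plateau:
  assumes "0 < r"
  shows "bump (plateau c b r) (plateau_deriv c b r) (c - r) (b + r)"
proof -
  have "(plateau c b r has_real_derivative plateau_deriv c b r x) (at x)" for x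
    unfolding plateau_def[abs_def] plateau_deriv_def
    by (rule DERIV_cong, (rule derivative_intros)+) (use assms in \<open>auto simp: field_simps\<close>)
  moreover have "continuous_on UNIV (plateau_deriv c b r)"
    unfolding plateau_deriv_def[abs_def] using assms by (intro continuous_intros) auto
  moreover have "1 - (ramp_square (x - b) + ramp_square (c - x)) / r\<^sup>2 \<le> 0"
    if x: "x \<notin> {c - r<..<b + r}" for x
  proof -
    have "r \<le> max 0 (x - b) \<or> r \<le> max 0 (c - x)" using x by auto
    then have "r\<^sup>2 \<le> ramp_square (x - b) \<or> r\<^sup>2 \<le> ramp_square (c - x)"
      unfolding ramp_square_def using assms by (meson less_imp_le power_mono)
    moreover have "0 \<le> ramp_square (x - b)" "0 \<le> ramp_square (c - x)"
      by (simp_all add: ramp_square_def)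
    ultimately have "r\<^sup>2 \<le> ramp_square (x - b) + ramp_square (c - x)" by linarith
    then show ?thesis using assms by (simp add: field_simps)
  qed
  then have "x \<notin> {c - r<..<b + r} \<Longrightarrow> plateau c b r x = 0 \<and> plateau_deriv c b r x = 0" for x
    unfolding plateau_def plateau_deriv_def by (simp add: ramp_square_def max.absorb1)
  ultimately show ?thesis unfolding bump_def by blast
qed

lemma integrable_continuous_scaleR_bounded:
  fixes k :: "'c::euclidean_space \<Rightarrow> real" and w :: "'c \<Rightarrow> 'b::euclidean_space"
  assumes k: "continuous_on UNIV k" and supp: "\<And>z. r < norm z \<Longrightarrow> k z = 0"
    and w: "w \<in> borel_measurable borel" and bdd: "bounded (range w)"
  shows "integrable lborel (\<lambda>z. k z *\<^sub>R w z)"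
proof -
  obtain B where B: "\<And>z. norm (w z) \<le> B" using bdd by (auto simp: bounded_iff)
  have "bounded (k ` cball 0 r)"
    by (intro compact_imp_bounded compact_continuous_image continuous_on_subset[OF k]) auto
  then obtain C where C: "\<And>z. z \<in> cball 0 r \<Longrightarrow> \<bar>k z\<bar> \<le> C"
    unfolding bounded_iff by (metis imageI real_norm_def)
  have km: "k \<in> borel_measurable borel" using k by (rule borel_measurable_continuous_onI)
  show ?thesis
  proof (rule integrableI_bounded_set[where A = "cball 0 r" and B = "C * B"])
    show "(\<lambda>z. k z *\<^sub>R w z) \<in> borel_measurable lborel" using km w by measurable
    show "emeasure lborel (cball (0::'c) r) < \<infinity>" by (rule emeasure_lborel_cball_finite)
    show "AE z in lborel. z \<in> cball 0 r \<longrightarrow> norm (k z *\<^sub>R w z) \<le> C * B"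
    proof (intro AE_I2 impI)
      fix z :: 'c assume "z \<in> cball 0 r"
      then have "\<bar>k z\<bar> \<le> C" by (rule C)
      then have "\<bar>k z\<bar> * norm (w z) \<le> C * B" using B[of z] by (intro mult_mono) auto
      then show "norm (k z *\<^sub>R w z) \<le> C * B" by simp
    qed
    show "AE z in lborel. z \<notin> cball 0 r \<longrightarrow> k z *\<^sub>R w z = 0"
      using supp by (auto intro!: AE_I2)
  qed auto
qed

lemma bump_support:
  assumes "bump \<theta> \<theta>' l u" "max \<bar>l\<bar> \<bar>u\<bar> < norm x" shows "\<theta> x = 0" "\<theta>' x = 0"
proof -
  have "x \<notin> {l<..<u}" using assms(2) by auto
  then show "\<theta> x = 0" "\<theta>' x = 0" using assms(1) unfolding bump_def by blast+
qed

text \<open>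
  Integration by parts, in the form in which it removes the \<open>t\<close>-derivative of a test function that
  is a product of a function of \<open>x / t\<close> and a function of \<open>t\<close>.
\<close>

lemma bump_first_moment_deriv:
  assumes \<psi>: "bump \<psi> \<psi>' l u" and lu: "l \<le> u"
  shows "(LINT t|lborel. t * \<psi>' t) = - (LINT t|lborel. \<psi> t)"
proof -
  note [continuous_intros] = bump_continuous[OF \<psi>]
  have c: "continuous_on UNIV \<psi>'" and d: "\<And>x. (\<psi> has_real_derivative \<psi>' x) (at x)"
    using \<psi> by (auto simp: bump_def)
  have i1: "integrable lborel (\<lambda>t. t * \<psi>' t)"
    using integrable_continuous_scaleR_bounded[of "\<lambda>t. t * \<psi>' t" "max \<bar>l\<bar> \<bar>u\<bar>" "\<lambda>_. 1::real"]
      bump_support[OF \<psi>] continuous_on_mult[OF continuous_on_id c] by auto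
  have i2: "integrable lborel \<psi>"
    using integrable_continuous_scaleR_bounded[of "\<psi>" "max \<bar>l\<bar> \<bar>u\<bar>" "\<lambda>_. 1::real"]
      bump_support[OF \<psi>] by (auto intro!: continuous_intros)
  have "(LINT t|lborel. indicator {l..u} t *\<^sub>R (t * \<psi>' t + \<psi> t)) = u * \<psi> u - l * \<psi> l"
  proof (rule integral_FTC_Icc[OF lu])
    show "((\<lambda>t. t * \<psi> t) has_vector_derivative t * \<psi>' t + \<psi> t) (at t within {l..u})" for t
      unfolding has_real_derivative_iff_has_vector_derivative[symmetric]
      by (rule DERIV_cong[OF DERIV_mult[OF DERIV_ident has_field_derivative_at_within[OF d]]]) simp
    show "continuous_on {l..u} (\<lambda>t. t * \<psi>' t + \<psi> t)"
      by (intro continuous_intros continuous_on_subset[OF c] continuous_on_subset[OF bump_continuous[OF \<psi>]]) auto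
  qed
  moreover have "\<psi> u = 0" "\<psi> l = 0" using \<psi> by (auto simp: bump_def)
  moreover have "(\<lambda>t. indicator {l..u} t *\<^sub>R (t * \<psi>' t + \<psi> t)) = (\<lambda>t. t * \<psi>' t + \<psi> t)"
  proof
    fix t
    have "t \<notin> {l..u} \<Longrightarrow> \<psi> t = 0 \<and> \<psi>' t = 0" using \<psi> unfolding bump_def by auto
    then show "indicator {l..u} t *\<^sub>R (t * \<psi>' t + \<psi> t) = t * \<psi>' t + \<psi> t"
      by (cases "t \<in> {l..u}") (simp_all only: indicator_simps, auto)
  qed
  ultimately have "(LINT t|lborel. t * \<psi>' t + \<psi> t) = 0" by simp
  then show ?thesis using i1 i2 by simp
qed

lemma plateau_integral_pos:
  assumes "0 < r" "c \<le> b"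
  shows "0 < (LINT t|lborel. plateau c b r t)"
proof -
  note b = bump_plateau[OF assms(1), of c b]
  have i: "integrable lborel (plateau c b r)"
    using integrable_continuous_scaleR_bounded[of "plateau c b r" "max \<bar>c-r\<bar> \<bar>b+r\<bar>" "\<lambda>_. 1::real"]
      bump_support[OF b] bump_continuous[OF b] by auto
  have "{c - r<..<b+r} \<subseteq> {t. plateau c b r t \<noteq> 0}"
  proof
    fix t assume t: "t \<in> {c - r<..<b+r}"
    have "ramp_square (t - b) < r\<^sup>2" "ramp_square (c - t) < r\<^sup>2"
      using t assms unfolding ramp_square_def by (auto intro!: power_strict_mono)
    moreover have "ramp_square (t - b) = 0 \<or> ramp_square (c - t) = 0"
      using assms by (auto simp: ramp_square_def)
    ultimately have "ramp_square (t - b) + ramp_square (c - t) < r\<^sup>2" by auto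
    then have "0 < 1 - (ramp_square (t - b) + ramp_square (c - t)) / r\<^sup>2"
      using assms by (simp add: divide_less_eq_1_pos)
    moreover have "y > 0 \<Longrightarrow> ramp_square y \<noteq> 0" for y by (simp add: ramp_square_def)
    ultimately show "t \<in> {t. plateau c b r t \<noteq> 0}" unfolding plateau_def by blast
  qed
  moreover have "emeasure lborel {c - r<..<b+r} \<noteq> 0" using assms by simp
  ultimately have "\<not> (AE t in lborel. plateau c b r t = 0)"
  proof (intro notI)
    assume sub: "{c - r<..<b+r} \<subseteq> {t. plateau c b r t \<noteq> 0}"
      and ne: "emeasure lborel {c - r<..<b+r} \<noteq> 0"
      and ae: "AE t in lborel. plateau c b r t = 0"
    from ae have "AE t in lborel. t \<notin> {c - r<..<b+r}"
      by (rule eventually_mono) (use sub in blast)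
    then have "{c - r<..<b+r} \<in> null_sets lborel" by (subst AE_iff_null_sets) auto
    then show False using ne null_setsD1 by blast
  qed
  then have "(LINT t|lborel. plateau c b r t) \<noteq> 0"
    using integral_nonneg_eq_0_iff_AE[OF i] plateau_nonneg by auto
  moreover have "0 \<le> (LINT t|lborel. plateau c b r t)" using plateau_nonneg by (intro integral_nonneg_AE) auto
  ultimately show ?thesis by simp
qed

section \<open>The weak formulation along rays\<close>

text \<open>
  Self-similar solutions are tested with \<open>\<theta> (x / t) * \<psi> t\<close>, where \<open>\<psi>\<close> is supported in \<open>t > 1\<close>.  Then the
  initial data do not contribute, and \<open>x = \<xi> t\<close> separates the two variables.  In the derivatives the
  denominator is \<open>max 1 t\<close>: this agrees with \<open>t\<close> on the support and makes both functions continuous on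
  the whole plane.
\<close>

definition ray_test :: "(real \<Rightarrow> real) \<Rightarrow> (real \<Rightarrow> real) \<Rightarrow> real \<times> real \<Rightarrow> real" where
  "ray_test \<theta> \<psi> z = \<theta> (fst z / snd z) * \<psi> (snd z)"

definition ray_test_dx :: "(real \<Rightarrow> real) \<Rightarrow> (real \<Rightarrow> real) \<Rightarrow> real \<times> real \<Rightarrow> real" where
  "ray_test_dx \<theta>' \<psi> z = \<theta>' (fst z / max 1 (snd z)) * \<psi> (snd z) / max 1 (snd z)"

definition ray_test_dt ::
  "(real \<Rightarrow> real) \<Rightarrow> (real \<Rightarrow> real) \<Rightarrow> (real \<Rightarrow> real) \<Rightarrow> (real \<Rightarrow> real) \<Rightarrow> real \<times> real \<Rightarrow> real" where
  "ray_test_dt \<theta> \<theta>' \<psi> \<psi>' z =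
     \<theta> (fst z / max 1 (snd z)) * \<psi>' (snd z) -
     fst z / (max 1 (snd z))\<^sup>2 * \<theta>' (fst z / max 1 (snd z)) * \<psi> (snd z)"

lemmas ray_test_defs = ray_test_def ray_test_dx_def ray_test_dt_def

lemma test_function_ray_test:
  assumes \<theta>: "bump \<theta> \<theta>' l u" and \<psi>: "bump \<psi> \<psi>' 1 m"
  shows "test_function (ray_test \<theta> \<psi>) (ray_test_dx \<theta>' \<psi>) (ray_test_dt \<theta> \<theta>' \<psi> \<psi>')"
    and "\<And>z. max 1 \<bar>m\<bar> * (max \<bar>l\<bar> \<bar>u\<bar> + 1) < norm z \<Longrightarrow>
           ray_test_dx \<theta>' \<psi> z = 0 \<and> ray_test_dt \<theta> \<theta>' \<psi> \<psi>' z = 0"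
proof -
  have c: "continuous_on UNIV \<theta>'" "continuous_on UNIV \<psi>'" "continuous_on UNIV \<theta>" "continuous_on UNIV \<psi>"
    using \<theta> \<psi> bump_continuous by (auto simp: bump_def)
  have c1: "continuous_on UNIV (\<lambda>z. k (fst z / max 1 (snd z)))"
    if "continuous_on UNIV k" for k :: "real \<Rightarrow> real"
    by (rule continuous_on_compose2[OF that]) (auto intro!: continuous_intros)
  have c2: "continuous_on UNIV (\<lambda>z::real \<times> real. k (snd z))"
    if "continuous_on UNIV k" for k :: "real \<Rightarrow> real"
    by (rule continuous_on_compose2[OF that]) (auto intro!: continuous_intros)
  have d\<theta>: "(\<theta> has_real_derivative \<theta>' x) (at x)" and d\<psi>: "(\<psi> has_real_derivative \<psi>' x) (at x)" for x
    using \<theta> \<psi> by (auto simp: bump_def)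
  have z\<psi>: "\<psi> t = 0" "\<psi>' t = 0" if "t \<notin> {1<..<m}" for t using that \<psi> by (auto simp: bump_def)
  have far: "\<theta> (x / t) * \<psi> t = 0 \<and> \<theta>' (x / max 1 t) * \<psi> t = 0 \<and>
      \<theta> (x / max 1 t) * \<psi>' t = 0" if far: "max 1 \<bar>m\<bar> * (max \<bar>l\<bar> \<bar>u\<bar> + 1) < norm (x, t)" for x t
  proof (cases "t \<in> {1<..<m}")
    case True
    let ?K = "max \<bar>l\<bar> \<bar>u\<bar>"
    have "norm (x, t) \<le> \<bar>x\<bar> + \<bar>t\<bar>" by (rule order.trans[OF norm_Pair_le]) simp
    moreover have "\<bar>t\<bar> \<le> max 1 \<bar>m\<bar>" using True by auto
    ultimately have "max 1 \<bar>m\<bar> * ?K < \<bar>x\<bar>" using far by (simp add: algebra_simps)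
    moreover have "t * ?K \<le> max 1 \<bar>m\<bar> * ?K" using True by (intro mult_right_mono) auto
    ultimately have "t * ?K < \<bar>x\<bar>" by linarith
    then have "?K < \<bar>x\<bar> / t"
      using True by (simp add: pos_less_divide_eq mult.commute del: max_less_iff_conj)
    then have "?K < norm (x / t)" using True by simp
    from bump_support[OF \<theta> this] show ?thesis using True by (simp add: max_def)
  next
    case False
    then show ?thesis by (simp add: z\<psi>)
  qed
  let ?\<phi> = "ray_test \<theta> \<psi>" and ?\<phi>x = "ray_test_dx \<theta>' \<psi>" and ?\<phi>t = "ray_test_dt \<theta> \<theta>' \<psi> \<psi>'"
  show "?\<phi>x z = 0 \<and> ?\<phi>t z = 0" if "max 1 \<bar>m\<bar> * (max \<bar>l\<bar> \<bar>u\<bar> + 1) < norm z" for z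
    using far[of "fst z" "snd z"] that by (auto simp: ray_test_defs)
  show "test_function ?\<phi> ?\<phi>x ?\<phi>t"
    unfolding test_function_def
  proof (intro conjI allI)
    have nz: "max 1 b \<noteq> 0" for b :: real using max.cobounded1[of 1 b] by linarith
    show "continuous_on UNIV ?\<phi>x"
      unfolding ray_test_defs by (intro continuous_intros c1 c2 c) (simp add: nz)
    show "continuous_on UNIV ?\<phi>t"
      unfolding ray_test_defs by (intro continuous_intros c1 c2 c) (simp add: nz)
    show "((\<lambda>y. ?\<phi> (y, t)) has_real_derivative ?\<phi>x (x, t)) (at x)" for x t
    proof (cases "t \<in> {1<..<m}")
      case True
      have "((\<lambda>y. \<theta> (y / t)) has_real_derivative \<theta>' (x / t) * (1 / t)) (at x)"
        by (rule DERIV_chain2[OF d\<theta>]) (use True in \<open>auto intro!: derivative_eq_intros\<close>)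
      from DERIV_cmult_right[OF this, of "\<psi> t"] show ?thesis using True by (simp add: max_def ray_test_defs)
    next
      case False
      then show ?thesis by (simp add: z\<psi> ray_test_defs)
    qed
    show "((\<lambda>s. ?\<phi> (x, s)) has_real_derivative ?\<phi>t (x, t)) (at t)" for x t
    proof (cases "1 \<le> t")
      case True
      have "((\<lambda>s. x / s) has_real_derivative - (x / t\<^sup>2)) (at t)"
        using True by (auto intro!: derivative_eq_intros simp: power2_eq_square)
      from DERIV_mult[OF DERIV_chain2[OF d\<theta> this] d\<psi>]
      show ?thesis using True by (simp add: max_def algebra_simps ray_test_defs)
    next
      case False
      have "((\<lambda>s. 0) has_real_derivative ?\<phi>t (x, t)) (at t)" using False by (simp add: z\<psi> ray_test_defs)
      then show ?thesis
        by (rule has_field_derivative_transform_within_open[where S = "{..<1}"])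
           (use False in \<open>auto simp: z\<psi> ray_test_defs\<close>)
    qed
    show "\<exists>r. \<forall>z. r < norm z \<longrightarrow> ?\<phi> z = 0" using far by (fastforce simp: ray_test_defs)
  qed
qed

lemma bounded_measurable_self_similar:
  assumes "bdd_measurable w"
  shows "(\<lambda>z::real\<times>real. w (fst z / snd z)) \<in> borel_measurable borel"
    "bounded (range (\<lambda>z::real\<times>real. w (fst z / snd z)))"
proof -
  have [measurable]: "w \<in> borel_measurable borel" using assms by (simp add: bdd_measurable_def)
  have "(\<lambda>z. w (fst z / snd z)) \<in> borel_measurable (borel \<Otimes>\<^sub>M borel)" by measurable
  then show "(\<lambda>z::real\<times>real. w (fst z / snd z)) \<in> borel_measurable borel" by (simp add: borel_prod)
  show "bounded (range (\<lambda>z::real\<times>real. w (fst z / snd z)))"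
    using assms unfolding bdd_measurable_def by (rule conjE) (erule bounded_subset, auto)
qed

lemma integrable_bump_scaleR:
  assumes "bump \<theta> \<theta>' l u" "bdd_measurable w"
  shows "integrable lborel (\<lambda>\<xi>. \<theta> \<xi> *\<^sub>R w \<xi>)" "integrable lborel (\<lambda>\<xi>. \<theta>' \<xi> *\<^sub>R w \<xi>)"
    "integrable lborel (\<lambda>\<xi>. (\<xi> * \<theta>' \<xi>) *\<^sub>R w \<xi>)"
proof -
  have c: "continuous_on UNIV \<theta>'" "continuous_on UNIV \<theta>"
    using assms bump_continuous by (auto simp: bump_def)
  have w: "w \<in> borel_measurable borel" "bounded (range w)"
    using assms by (auto simp: bdd_measurable_def)
  note supp = bump_support[OF assms(1)]
  show "integrable lborel (\<lambda>\<xi>. \<theta> \<xi> *\<^sub>R w \<xi>)" "integrable lborel (\<lambda>\<xi>. \<theta>' \<xi> *\<^sub>R w \<xi>)"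
    "integrable lborel (\<lambda>\<xi>. (\<xi> * \<theta>' \<xi>) *\<^sub>R w \<xi>)"
    by (rule integrable_continuous_scaleR_bounded[where r = "max \<bar>l\<bar> \<bar>u\<bar>", OF _ _ w],
        (intro continuous_intros c; fail), simp add: supp)+
qed

text \<open>
  The substitution \<open>x = \<xi> t\<close> turns the integral over the half plane into an iterated one, in which the
  inner integral over \<open>\<xi>\<close> is a combination of two constants with the coefficients \<open>t * \<psi>' t\<close> and \<open>\<psi> t\<close>.
  Integrating \<open>t * \<psi>' t\<close> by parts leaves a single factor \<open>LINT t|lborel. \<psi> t\<close>.  What remains is the weak form of the
  ordinary differential equation \<open>(g - \<xi> w)' + w = 0\<close> for the profile.
\<close>

lemma weak_form_self_similar:
  fixes w g :: "real \<Rightarrow> 'b::euclidean_space"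
  assumes \<theta>: "bump \<theta> \<theta>' l u" and \<psi>: "bump \<psi> \<psi>' 1 m" and m: "1 \<le> m"
    and w: "bdd_measurable w" and g: "bdd_measurable g"
  shows "weak_form (ray_test \<theta> \<psi>) (ray_test_dx \<theta>' \<psi>) (ray_test_dt \<theta> \<theta>' \<psi> \<psi>') w g wL wR =
         (LINT t|lborel. \<psi> t) *\<^sub>R (LINT \<xi>|lborel. \<theta>' \<xi> *\<^sub>R (g \<xi> - \<xi> *\<^sub>R w \<xi>) - \<theta> \<xi> *\<^sub>R w \<xi>)"
    (is "weak_form ?\<phi> ?\<phi>x ?\<phi>t w g wL wR = _")
proof -
  let ?\<phi> = "ray_test \<theta> \<psi>" and ?\<phi>x = "ray_test_dx \<theta>' \<psi>" and ?\<phi>t = "ray_test_dt \<theta> \<theta>' \<psi> \<psi>'"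
  let ?f = "\<lambda>x t. ?\<phi>t (x, t) *\<^sub>R w (x / t) + ?\<phi>x (x, t) *\<^sub>R g (x / t)"
  have z\<psi>: "\<psi> t = 0" "\<psi>' t = 0" if "t \<notin> {1<..<m}" for t using that \<psi> by (auto simp: bump_def)
  have cont: "continuous_on UNIV ?\<phi>x" "continuous_on UNIV ?\<phi>t"
    using test_function_ray_test(1)[OF \<theta> \<psi>] unfolding test_function_def by blast+
  note supp = test_function_ray_test(2)[OF \<theta> \<psi>]
  have int: "integrable lborel (\<lambda>z::real\<times>real. ?\<phi>t z *\<^sub>R w (fst z / snd z) + ?\<phi>x z *\<^sub>R g (fst z / snd z))"
    by (rule Bochner_Integration.integrable_add;
        rule integrable_continuous_scaleR_bounded[where r = "max 1 \<bar>m\<bar> * (max \<bar>l\<bar> \<bar>u\<bar> + 1)"];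
        (rule cont bounded_measurable_self_similar[OF w] bounded_measurable_self_similar[OF g])?; (use supp in blast)?)
  let ?A = "LINT \<xi>|lborel. \<theta> \<xi> *\<^sub>R w \<xi>"
  let ?B = "LINT \<xi>|lborel. \<theta>' \<xi> *\<^sub>R g \<xi>"
  let ?C = "LINT \<xi>|lborel. (\<xi> * \<theta>' \<xi>) *\<^sub>R w \<xi>"
  note iw = integrable_bump_scaleR[OF \<theta> w] and ig = integrable_bump_scaleR[OF \<theta> g]
  have inner: "(LINT x|lborel. ?f x t) = (t * \<psi>' t) *\<^sub>R ?A + \<psi> t *\<^sub>R (?B - ?C)" for t
  proof (cases "t \<in> {1<..<m}")
    case True
    then have t: "0 < t" "max 1 t = t" by auto
    have "(LINT x|lborel. ?f x t) = \<bar>t\<bar> *\<^sub>R (LINT \<xi>|lborel. ?f (0 + t * \<xi>) t)"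
      using t by (intro lborel_integral_real_affine) auto
    also have "(\<lambda>\<xi>. ?f (0 + t * \<xi>) t) = (\<lambda>\<xi>. \<psi>' t *\<^sub>R \<theta> \<xi> *\<^sub>R w \<xi> +
        ((\<psi> t / t) *\<^sub>R \<theta>' \<xi> *\<^sub>R g \<xi> - (\<psi> t / t) *\<^sub>R (\<xi> * \<theta>' \<xi>) *\<^sub>R w \<xi>))"
      using t by (simp add: fun_eq_iff algebra_simps power2_eq_square ray_test_defs)
    also have "(LINT \<xi>|lborel. \<psi>' t *\<^sub>R \<theta> \<xi> *\<^sub>R w \<xi> +
        ((\<psi> t / t) *\<^sub>R \<theta>' \<xi> *\<^sub>R g \<xi> - (\<psi> t / t) *\<^sub>R (\<xi> * \<theta>' \<xi>) *\<^sub>R w \<xi>)) =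
        \<psi>' t *\<^sub>R ?A + ((\<psi> t / t) *\<^sub>R ?B - (\<psi> t / t) *\<^sub>R ?C)"
      using iw ig by (simp del: scaleR_scaleR)
    finally show ?thesis using t by (simp add: algebra_simps)
  next
    case False
    then show ?thesis by (simp add: z\<psi> ray_test_defs)
  qed
  have "set_lebesgue_integral lborel {z. 0 < snd z}
       (\<lambda>z. ?\<phi>t z *\<^sub>R w (fst z / snd z) + ?\<phi>x z *\<^sub>R g (fst z / snd z)) =
     (LINT z|lborel. ?\<phi>t z *\<^sub>R w (fst z / snd z) + ?\<phi>x z *\<^sub>R g (fst z / snd z))"
    unfolding set_lebesgue_integral_def
    by (rule Bochner_Integration.integral_cong[OF refl]) (auto simp: indicator_def z\<psi> ray_test_defs)
  also have "\<dots> = integral\<^sup>L (lborel \<Otimes>\<^sub>M lborel) (\<lambda>(x, t). ?f x t)"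
    by (simp add: lborel_prod case_prod_unfold)
  also have "\<dots> = (LINT t|lborel. LINT x|lborel. ?f x t)"
    using int by (intro lborel_pair.integral_snd[symmetric]) (simp add: lborel_prod case_prod_unfold)
  also have "\<dots> = (LINT t|lborel. (t * \<psi>' t) *\<^sub>R ?A + \<psi> t *\<^sub>R (?B - ?C))"
    by (simp only: inner)
  also have "\<dots> = (LINT t|lborel. t * \<psi>' t) *\<^sub>R ?A + (LINT t|lborel. \<psi> t) *\<^sub>R (?B - ?C)"
  proof -
    have "bdd_measurable (\<lambda>_::real. 1::real)" by (simp add: bdd_measurable_def)
    from integrable_bump_scaleR[OF \<psi> this] show ?thesis by simp
  qed
  also have "\<dots> = (LINT t|lborel. \<psi> t) *\<^sub>R (?B - ?C - ?A)"
    using bump_first_moment_deriv[OF \<psi> m] by (simp add: algebra_simps)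
  also have "?B - ?C - ?A = (LINT \<xi>|lborel. \<theta>' \<xi> *\<^sub>R g \<xi> - (\<xi> * \<theta>' \<xi>) *\<^sub>R w \<xi> - \<theta> \<xi> *\<^sub>R w \<xi>)"
    using iw ig by simp
  also have "(\<lambda>\<xi>. \<theta>' \<xi> *\<^sub>R g \<xi> - (\<xi> * \<theta>' \<xi>) *\<^sub>R w \<xi> - \<theta> \<xi> *\<^sub>R w \<xi>) =
     (\<lambda>\<xi>. \<theta>' \<xi> *\<^sub>R (g \<xi> - \<xi> *\<^sub>R w \<xi>) - \<theta> \<xi> *\<^sub>R w \<xi>)"
    by (simp add: fun_eq_iff algebra_simps)
  finally show ?thesis unfolding weak_form_def by (simp add: z\<psi> ray_test_defs)
qed

lemma self_similar_weak_equation: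
  assumes "bump \<theta> \<theta>' l u" "bdd_measurable w" "bdd_measurable g"
    and "\<And>\<phi> \<phi>x \<phi>t. test_function \<phi> \<phi>x \<phi>t \<Longrightarrow> weak_form \<phi> \<phi>x \<phi>t w g wL wR = 0"
  shows "(LINT \<xi>|lborel. \<theta>' \<xi> *\<^sub>R (g \<xi> - \<xi> *\<^sub>R w \<xi>) - \<theta> \<xi> *\<^sub>R w \<xi>) = 0"
proof -
  have \<psi>: "bump (plateau 2 2 1) (plateau_deriv 2 2 1) 1 3" using bump_plateau[of 1 2 2] by simp
  have "weak_form (ray_test \<theta> (plateau 2 2 1)) (ray_test_dx \<theta>' (plateau 2 2 1))
      (ray_test_dt \<theta> \<theta>' (plateau 2 2 1) (plateau_deriv 2 2 1)) w g wL wR = 0"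
    by (intro assms(4) test_function_ray_test(1)[OF assms(1) \<psi>])
  then show ?thesis
    using weak_form_self_similar[OF assms(1) \<psi> _ assms(2,3), of wL wR]
      plateau_integral_pos[of 1 2 2] by simp
qed

lemma self_similar_weak_inequality:
  fixes w g :: "real \<Rightarrow> real"
  assumes "bump \<theta> \<theta>' l u" "bdd_measurable w" "bdd_measurable g" and nonneg: "\<And>x. 0 \<le> \<theta> x"
    and "\<And>\<phi> \<phi>x \<phi>t. test_function \<phi> \<phi>x \<phi>t \<Longrightarrow> \<forall>z. 0 \<le> \<phi> z \<Longrightarrow> 0 \<le> weak_form \<phi> \<phi>x \<phi>t w g wL wR"
  shows "0 \<le> (LINT \<xi>|lborel. \<theta>' \<xi> *\<^sub>R (g \<xi> - \<xi> *\<^sub>R w \<xi>) - \<theta> \<xi> *\<^sub>R w \<xi>)"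
proof -
  have \<psi>: "bump (plateau 2 2 1) (plateau_deriv 2 2 1) 1 3" using bump_plateau[of 1 2 2] by simp
  have "0 \<le> weak_form (ray_test \<theta> (plateau 2 2 1)) (ray_test_dx \<theta>' (plateau 2 2 1))
      (ray_test_dt \<theta> \<theta>' (plateau 2 2 1) (plateau_deriv 2 2 1)) w g wL wR"
    by (intro assms(5) test_function_ray_test(1)[OF assms(1) \<psi>])
       (simp add: ray_test_def nonneg plateau_nonneg)
  then show ?thesis
    using weak_form_self_similar[OF assms(1) \<psi> _ assms(2,3), of wL wR]
      plateau_integral_pos[of 1 2 2] by (simp add: zero_le_mult_iff)
qed

section \<open>Mean values over the Riemann fan\<close>

text \<open>
  On a constant state the integrand of the weak equation is the derivative of \<open>\<theta> * (d - \<xi> c)\<close>.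
\<close>

lemma bump_constant_state_integral:
  fixes c d :: "'b::euclidean_space"
  assumes \<theta>: "bump \<theta> \<theta>' l u" and xy: "x \<le> y"
  shows "has_bochner_integral lborel
     (\<lambda>\<xi>. indicator {x..y} \<xi> *\<^sub>R (\<theta>' \<xi> *\<^sub>R (d - \<xi> *\<^sub>R c) - \<theta> \<xi> *\<^sub>R c))
     (\<theta> y *\<^sub>R (d - y *\<^sub>R c) - \<theta> x *\<^sub>R (d - x *\<^sub>R c))"
proof (rule has_bochner_integral_FTC_Icc[OF xy])
  have D: "(\<theta> has_vector_derivative \<theta>' \<xi>) (at \<xi> within S)" for \<xi> S
    using \<theta> unfolding bump_def has_real_derivative_iff_has_vector_derivative[symmetric]
    by (blast intro: has_field_derivative_at_within)
  have D': "(\<theta> has_real_derivative \<theta>' \<xi>) (at \<xi> within S)" for \<xi> S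
    using D has_real_derivative_iff_has_vector_derivative by blast
  show "((\<lambda>\<xi>. \<theta> \<xi> *\<^sub>R (d - \<xi> *\<^sub>R c)) has_vector_derivative \<theta>' \<xi> *\<^sub>R (d - \<xi> *\<^sub>R c) - \<theta> \<xi> *\<^sub>R c)
     (at \<xi> within {x..y})" for \<xi>
    by (rule has_vector_derivative_eq_rhs[OF has_vector_derivative_scaleR[OF D'
          has_vector_derivative_diff[OF has_vector_derivative_const
            has_vector_derivative_scaleR[OF DERIV_ident has_vector_derivative_const]]]]) simp
  have c: "continuous_on UNIV \<theta>'" "continuous_on UNIV \<theta>"
    using assms bump_continuous by (auto simp: bump_def)
  show "continuous_on {x..y} (\<lambda>\<xi>. \<theta>' \<xi> *\<^sub>R (d - \<xi> *\<^sub>R c) - \<theta> \<xi> *\<^sub>R c)"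
    by (intro continuous_intros c[THEN continuous_on_subset]) auto
qed

text \<open>
  Outside the fan \<open>\<bar>\<xi>\<bar> \<le> a\<close> both states are constant, so there the weak equation reduces to boundary
  terms at \<open>- a\<close> and \<open>a\<close>.  The choice of \<open>\<theta>\<close> decides what is read off: a plateau over the whole fan
  gives the mean value of the solution, and a bump at one edge gives the jump condition there.
\<close>

lemma riemann_balance:
  fixes w g :: "real \<Rightarrow> 'b::euclidean_space"
  assumes \<theta>: "bump \<theta> \<theta>' l u" and w: "bdd_measurable w" and g: "bdd_measurable g" and a: "0 < a"
    and left: "\<And>\<xi>. \<xi> < - a \<Longrightarrow> w \<xi> = wL \<and> g \<xi> = gL"
    and right: "\<And>\<xi>. a < \<xi> \<Longrightarrow> w \<xi> = wR \<and> g \<xi> = gR"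
  shows "(LINT \<xi>|lborel. \<theta>' \<xi> *\<^sub>R (g \<xi> - \<xi> *\<^sub>R w \<xi>) - \<theta> \<xi> *\<^sub>R w \<xi>) =
     \<theta> (- a) *\<^sub>R (gL + a *\<^sub>R wL) - \<theta> a *\<^sub>R (gR - a *\<^sub>R wR) +
     (LINT \<xi>:{- a..a}|lborel. \<theta>' \<xi> *\<^sub>R (g \<xi> - \<xi> *\<^sub>R w \<xi>) - \<theta> \<xi> *\<^sub>R w \<xi>)"
proof -
  define L where "L = Max {a, \<bar>l\<bar>, \<bar>u\<bar>}"
  have L: "a \<le> L" "\<bar>l\<bar> \<le> L" "\<bar>u\<bar> \<le> L" by (simp_all add: L_def)
  have "L \<notin> {l<..<u}" "- L \<notin> {l<..<u}" using L by auto
  then have \<theta>L: "\<theta> L = 0" "\<theta> (- L) = 0" using \<theta> unfolding bump_def by blast+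
  let ?k = "\<lambda>\<xi>. \<theta>' \<xi> *\<^sub>R (g \<xi> - \<xi> *\<^sub>R w \<xi>) - \<theta> \<xi> *\<^sub>R w \<xi>"
  let ?kc = "\<lambda>d c \<xi>. \<theta>' \<xi> *\<^sub>R (d - \<xi> *\<^sub>R c) - \<theta> \<xi> *\<^sub>R c"
  have ik: "integrable lborel ?k"
    using integrable_bump_scaleR[OF \<theta> w] integrable_bump_scaleR[OF \<theta> g]
    by (simp add: scaleR_diff_right mult.commute)
  have iL: "has_bochner_integral lborel (\<lambda>\<xi>. indicator {-L..-a} \<xi> *\<^sub>R ?kc gL wL \<xi>)
      (\<theta> (-a) *\<^sub>R (gL + a *\<^sub>R wL))"
    using bump_constant_state_integral[OF \<theta>, of "-L" "-a" gL wL] L \<theta>L by simp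
  have iR: "has_bochner_integral lborel (\<lambda>\<xi>. indicator {a..L} \<xi> *\<^sub>R ?kc gR wR \<xi>)
      (- (\<theta> a *\<^sub>R (gR - a *\<^sub>R wR)))"
    using bump_constant_state_integral[OF \<theta>, of "a" "L" gR wR] L \<theta>L by simp
  have iM: "has_bochner_integral lborel (\<lambda>\<xi>. indicator {-a..a} \<xi> *\<^sub>R ?k \<xi>)
      (LINT \<xi>:{- a..a}|lborel. ?k \<xi>)"
    unfolding set_lebesgue_integral_def
    by (intro has_bochner_integral_integrable integrable_mult_indicator ik) simp
  note sum = has_bochner_integral_add[OF has_bochner_integral_add[OF iL iR] iM]
  (* At the two edges of the fan the indicators overlap. *)
  have "AE \<xi> in lborel. \<xi> \<noteq> a \<and> \<xi> \<noteq> - a"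
    using AE_lborel_singleton[of a] AE_lborel_singleton[of "-a"] by eventually_elim auto
  then have "AE \<xi> in lborel. ?k \<xi> = indicator {-L..-a} \<xi> *\<^sub>R ?kc gL wL \<xi> +
      indicator {a..L} \<xi> *\<^sub>R ?kc gR wR \<xi> + indicator {-a..a} \<xi> *\<^sub>R ?k \<xi>"
  proof eventually_elim
    case (elim \<xi>)
    have out: "\<theta> \<xi> = 0" "\<theta>' \<xi> = 0" if "L < \<bar>\<xi>\<bar>" using bump_support[OF \<theta>, of \<xi>] that L by auto
    consider "\<xi> < - L" | "- L \<le> \<xi>" "\<xi> < - a" | "- a < \<xi>" "\<xi> < a" | "a < \<xi>" "\<xi> \<le> L" | "L < \<xi>"
      using elim by linarith
    then show ?case
      by cases (use L a left right out in \<open>auto simp: indicator_def\<close>)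
  qed
  then have "(LINT \<xi>|lborel. ?k \<xi>) = (LINT \<xi>|lborel. indicator {-L..-a} \<xi> *\<^sub>R ?kc gL wL \<xi> +
      indicator {a..L} \<xi> *\<^sub>R ?kc gR wR \<xi> + indicator {-a..a} \<xi> *\<^sub>R ?k \<xi>)"
    using borel_measurable_integrable[OF ik] borel_measurable_has_bochner_integral[OF sum]
    by (intro integral_cong_AE) auto
  also have "\<dots> = \<theta> (-a) *\<^sub>R (gL + a *\<^sub>R wL) + - (\<theta> a *\<^sub>R (gR - a *\<^sub>R wR)) + (LINT \<xi>:{- a..a}|lborel. ?k \<xi>)"
    using sum by (rule has_bochner_integral_integral_eq)
  finally show ?thesis by simp
qed

lemma riemann_fan_balance:
  fixes w g :: "real \<Rightarrow> 'b::euclidean_space"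
  assumes "bdd_measurable w" "bdd_measurable g" "0 < a"
    and "\<And>\<xi>. \<xi> < - a \<Longrightarrow> w \<xi> = wL \<and> g \<xi> = gL"
    and "\<And>\<xi>. a < \<xi> \<Longrightarrow> w \<xi> = wR \<and> g \<xi> = gR"
  shows "(LINT \<xi>|lborel. plateau_deriv (- a) a 1 \<xi> *\<^sub>R (g \<xi> - \<xi> *\<^sub>R w \<xi>) - plateau (- a) a 1 \<xi> *\<^sub>R w \<xi>) =
     a *\<^sub>R (wL + wR) + (gL - gR) - (LINT \<xi>:{- a..a}|lborel. w \<xi>)"
proof -
  let ?k = "\<lambda>\<xi>. plateau_deriv (- a) a 1 \<xi> *\<^sub>R (g \<xi> - \<xi> *\<^sub>R w \<xi>) - plateau (- a) a 1 \<xi> *\<^sub>R w \<xi>"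
  have "(LINT \<xi>:{- a..a}|lborel. ?k \<xi>) = (LINT \<xi>:{- a..a}|lborel. - w \<xi>)"
    by (rule set_lebesgue_integral_cong) (auto simp: plateau_eq_1 plateau_deriv_eq_0)
  also have "\<dots> = - (LINT \<xi>:{- a..a}|lborel. w \<xi>)"
    by (simp add: set_lebesgue_integral_def)
  finally show ?thesis
    using riemann_balance[OF bump_plateau[of 1 "-a" a] assms] assms(3)
    by (simp add: plateau_eq_1 algebra_simps)
qed

text \<open>
  The intermediate state of the local Lax-Friedrichs flux, i.e. the state that \<open>U_tilde\<close> forms from
  two neighbouring averages.  If \<open>a\<close> bounds the wave speeds, it is the mean over \<open>[- a, a]\<close> of the
  solution of the Riemann problem.
\<close>

definition lf_state :: "('a::real_vector \<Rightarrow> 'a) \<Rightarrow> real \<Rightarrow> 'a \<Rightarrow> 'a \<Rightarrow> 'a" where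
  "lf_state F a UL UR = (1/2) *\<^sub>R (UL + UR) + (1 / (2 * a)) *\<^sub>R (F UL - F UR)"

lemma U_tilde_eq_lf_state: "U_tilde F \<alpha> V i = lf_state F (\<alpha> i) (avg V i) (avg V (i + 1))"
  by (simp add: U_tilde_def lf_state_def)

lemma lf_state_scaled: "0 < a \<Longrightarrow> (2 * a) *\<^sub>R lf_state F a UL UR = a *\<^sub>R (UL + UR) + (F UL - F UR)"
  by (simp add: lf_state_def algebra_simps)

lemma riemann_solution_entropy:
  assumes "riemann_solution F S P UL UR W" "(\<eta>, q) \<in> P"
  shows "bdd_measurable (\<eta> \<circ> W)" "bdd_measurable (q \<circ> W)"
    and "\<And>\<phi> \<phi>x \<phi>t. test_function \<phi> \<phi>x \<phi>t \<Longrightarrow> \<forall>z. 0 \<le> \<phi> z \<Longrightarrow>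
           0 \<le> weak_form \<phi> \<phi>x \<phi>t (\<eta> \<circ> W) (q \<circ> W) (\<eta> UL) (\<eta> UR)"
  using assms unfolding riemann_solution_def by blast+

lemma riemann_fan_entropy:
  assumes W: "riemann_solution F S P UL UR W" "(\<eta>, q) \<in> P" and a: "0 < a"
    and out: "\<And>\<xi>. \<xi> < - a \<Longrightarrow> W \<xi> = UL" "\<And>\<xi>. a < \<xi> \<Longrightarrow> W \<xi> = UR"
  shows "(LINT \<xi>:{- a..a}|lborel. \<eta> (W \<xi>)) \<le> a * (\<eta> UL + \<eta> UR) + (q UL - q UR)"
proof -
  note entropy = riemann_solution_entropy[OF W]
  have "(LINT \<xi>|lborel. plateau_deriv (- a) a 1 \<xi> *\<^sub>R ((q \<circ> W) \<xi> - \<xi> *\<^sub>R (\<eta> \<circ> W) \<xi>) -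
      plateau (- a) a 1 \<xi> *\<^sub>R (\<eta> \<circ> W) \<xi>) =
      a *\<^sub>R (\<eta> UL + \<eta> UR) + (q UL - q UR) - (LINT \<xi>:{- a..a}|lborel. (\<eta> \<circ> W) \<xi>)"
    by (rule riemann_fan_balance[OF entropy(1,2) a]) (simp_all add: out)
  moreover have "0 \<le> (LINT \<xi>|lborel. plateau_deriv (- a) a 1 \<xi> *\<^sub>R ((q \<circ> W) \<xi> - \<xi> *\<^sub>R (\<eta> \<circ> W) \<xi>) -
      plateau (- a) a 1 \<xi> *\<^sub>R (\<eta> \<circ> W) \<xi>)"
    by (rule self_similar_weak_inequality[OF bump_plateau[of 1 "-a" a] entropy(1,2) plateau_nonneg entropy(3)])
       simp_all
  ultimately show ?thesis by simp
qed

text \<open>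
  Let \<open>u\<close> be the intermediate state.  For a constant \<open>k\<close> above both \<open>uL\<close> and \<open>uR\<close>, the right-hand side of the
  Kruzhkov inequality in \<open>riemann_fan_entropy\<close> equals \<open>2 * a * (k - u)\<close>, and for \<open>k\<close> below both it equals
  \<open>2 * a * (u - k)\<close>.  It dominates the integral of \<open>\<bar>W - k\<bar>\<close> over the fan and is therefore nonnegative.
\<close>

lemma scalar_lf_state_between:
  assumes sp: "riemann_speed_bound f UNIV (kruzhkov_pairs f) uL uR a" and a: "0 < a"
    and L: "uL \<in> {m..M}" and R: "uR \<in> {m..M}"
  shows "lf_state f a uL uR \<in> {m..M}"
proof -
  obtain W where W: "riemann_solution f UNIV (kruzhkov_pairs f) uL uR W"
    and out: "\<And>\<xi>. \<xi> < - a \<Longrightarrow> W \<xi> = uL" "\<And>\<xi>. a < \<xi> \<Longrightarrow> W \<xi> = uR"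
    using sp unfolding riemann_speed_bound_def by blast
  have K: "0 \<le> a * (\<bar>uL - k\<bar> + \<bar>uR - k\<bar>) + (sgn (uL - k) * (f uL - f k) - sgn (uR - k) * (f uR - f k))"
    for k
  proof -
    let ?\<eta> = "\<lambda>u::real. \<bar>u - k\<bar>" and ?q = "\<lambda>u. sgn (u - k) * (f u - f k)"
    have "(?\<eta>, ?q) \<in> kruzhkov_pairs f" by (simp add: kruzhkov_pairs_def)
    from riemann_fan_entropy[OF W this a out]
    have "(LINT \<xi>:{- a..a}|lborel. ?\<eta> (W \<xi>)) \<le> a * (?\<eta> uL + ?\<eta> uR) + (?q uL - ?q uR)" .
    moreover have "0 \<le> (LINT \<xi>:{- a..a}|lborel. ?\<eta> (W \<xi>))"
      unfolding set_lebesgue_integral_def by (intro integral_nonneg_AE) auto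
    ultimately show ?thesis by linarith
  qed
  have tw: "2 * a * lf_state f a uL uR = a * (uL + uR) + (f uL - f uR)"
    using lf_state_scaled[OF a, of f uL uR] by simp
  have "0 \<le> 2 * a * (M - lf_state f a uL uR)"
  proof -
    have q: "sgn (u - M) * (f u - f M) = f M - f u" if "u \<in> {m..M}" for u
      using that by (cases "u = M") auto
    have "\<bar>uL - M\<bar> = M - uL" "\<bar>uR - M\<bar> = M - uR" using L R by auto
    with K[of M, unfolded q[OF L] q[OF R]]
    have "0 \<le> a * ((M - uL) + (M - uR)) + ((f M - f uL) - (f M - f uR))" by simp
    then show ?thesis using tw by (simp add: algebra_simps)
  qed
  moreover have "0 \<le> 2 * a * (lf_state f a uL uR - m)"
  proof -
    have q: "sgn (u - m) * (f u - f m) = f u - f m" if "u \<in> {m..M}" for u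
      using that by (cases "u = m") auto
    have "\<bar>uL - m\<bar> = uL - m" "\<bar>uR - m\<bar> = uR - m" using L R by auto
    with K[of m, unfolded q[OF L] q[OF R]]
    have "0 \<le> a * ((uL - m) + (uR - m)) + ((f uL - f m) - (f uR - f m))" by simp
    then show ?thesis using tw by (simp add: algebra_simps)
  qed
  ultimately show ?thesis using a by (simp add: zero_le_mult_iff)
qed

section \<open>The admissible states of the Euler equations\<close>

text \<open>
  The total energy seen by an observer with velocity \<open>v\<close>.  It is linear in the state, and for positive
  density its minimum over \<open>v\<close> is the internal energy \<open>pressure \<gamma> U / (\<gamma> - 1)\<close>.
\<close>

definition moving_energy :: "real \<Rightarrow> real^3 \<Rightarrow> real" where
  "moving_energy v U = U$3 - v * U$2 + v\<^sup>2 / 2 * U$1"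

lemma bounded_linear_moving_energy: "bounded_linear (moving_energy v)"
  unfolding moving_energy_def
  by (intro bounded_linear_add bounded_linear_sub bounded_linear_const_mult bounded_linear_vec_nth)

lemma moving_energy_pressure:
  assumes "U$1 \<noteq> 0" "1 < \<gamma>"
  shows "moving_energy v U = pressure \<gamma> U / (\<gamma> - 1) + U$1 / 2 * (v - U$2 / U$1)\<^sup>2"
  using assms by (simp add: moving_energy_def pressure_def field_simps power2_eq_square)

text \<open>
  Positivity of the pressure is nonlinear, but here it becomes a family of linear inequalities.  So
  \<open>euler_G \<gamma>\<close> is a convex cone, and it can be checked by applying linear functionals, in particular
  under an integral sign.
\<close>

lemma euler_G_iff:
  assumes "1 < \<gamma>"
  shows "U \<in> euler_G \<gamma> \<longleftrightarrow> 0 < U$1 \<and> (\<forall>v. 0 < moving_energy v U)"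
proof (cases "0 < U$1")
  case True
  have "0 < moving_energy v U" if "0 < pressure \<gamma> U" for v
    unfolding moving_energy_pressure[OF less_imp_neq[OF True, symmetric] assms]
    using True that assms by (intro add_pos_nonneg divide_pos_pos mult_nonneg_nonneg) auto
  moreover have "0 < pressure \<gamma> U" if "0 < moving_energy (U$2 / U$1) U"
    using that moving_energy_pressure[OF less_imp_neq[OF True, symmetric] assms, of "U$2 / U$1"] assms
    by (simp add: zero_less_divide_iff)
  ultimately show ?thesis using True unfolding euler_G_def by blast
qed (simp add: euler_G_def)

lemma euler_flux_nth [simp]:
  "euler_flux \<gamma> U $ 1 = U$2"
  "euler_flux \<gamma> U $ 2 = U$1 * (U$2 / U$1)\<^sup>2 + pressure \<gamma> U"
  "euler_flux \<gamma> U $ 3 = (U$3 + pressure \<gamma> U) * (U$2 / U$1)"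
  by (simp_all add: euler_flux_def Let_def)

lemma euler_flux_0: "euler_flux \<gamma> 0 = 0"
  by (simp add: vec_eq_iff forall_3 pressure_def)

text \<open>
  The weak equation identifies the intermediate state as the mean of \<open>W\<close> over the fan.  Each functional
  that defines \<open>euler_G \<gamma>\<close> is positive on \<open>euler_G \<gamma>\<close> and vanishes at the vacuum, so its mean is
  positive unless \<open>W\<close> is the vacuum almost everywhere in the fan.  In that case the jump condition
  \<open>F UL = - a *\<^sub>R UL\<close> at the left edge of the fan would hold, and it forces the pressure of \<open>UL\<close> to vanish:
  no shock separates a gas of positive pressure from vacuum.
\<close>

lemma euler_lf_state_in_G:
  assumes \<gamma>: "1 < \<gamma>"
    and sp: "riemann_speed_bound (euler_flux \<gamma>) (euler_states \<gamma>) P UL UR a" and a: "0 < a"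
    and UL: "UL \<in> euler_G \<gamma>"
  shows "lf_state (euler_flux \<gamma>) a UL UR \<in> euler_G \<gamma>"
proof -
  let ?F = "euler_flux \<gamma>"
  obtain W where W: "riemann_solution ?F (euler_states \<gamma>) P UL UR W"
    and out: "\<And>\<xi>. \<xi> < - a \<Longrightarrow> W \<xi> = UL" "\<And>\<xi>. a < \<xi> \<Longrightarrow> W \<xi> = UR"
    using sp unfolding riemann_speed_bound_def by blast
  have range: "W \<xi> = 0 \<or> W \<xi> \<in> euler_G \<gamma>" for \<xi>
    using W unfolding riemann_solution_def euler_states_def by blast
  have b: "bdd_measurable W" "bdd_measurable (?F \<circ> W)"
    and eq: "\<And>\<phi> \<phi>x \<phi>t. test_function \<phi> \<phi>x \<phi>t \<Longrightarrow> weak_form \<phi> \<phi>x \<phi>t W (?F \<circ> W) UL UR = 0"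
    using W unfolding riemann_solution_def by auto
  have no_vacuum: "\<not> (AE \<xi> in lborel. \<xi> \<in> {- a..a} \<longrightarrow> W \<xi> = 0)"
  proof
    assume vac: "AE \<xi> in lborel. \<xi> \<in> {- a..a} \<longrightarrow> W \<xi> = 0"
    (* This bump is 1 at the left edge of the fan and has already vanished at the right edge. *)
    let ?\<theta> = "plateau (-a) (-a) a" and ?\<theta>' = "plateau_deriv (-a) (-a) a"
    note bump = bump_plateau[OF a, of "-a" "-a"]
    have "0 = ?\<theta> (- a) *\<^sub>R (?F UL + a *\<^sub>R UL) - ?\<theta> a *\<^sub>R (?F UR - a *\<^sub>R UR) +
     (LINT \<xi>:{- a..a}|lborel. ?\<theta>' \<xi> *\<^sub>R ((?F \<circ> W) \<xi> - \<xi> *\<^sub>R W \<xi>) - ?\<theta> \<xi> *\<^sub>R W \<xi>)"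
      using riemann_balance[OF bump b a, of UL "?F UL" UR "?F UR"]
        self_similar_weak_equation[OF bump b eq] out by simp
    moreover have "(LINT \<xi>:{- a..a}|lborel. ?\<theta>' \<xi> *\<^sub>R ((?F \<circ> W) \<xi> - \<xi> *\<^sub>R W \<xi>) - ?\<theta> \<xi> *\<^sub>R W \<xi>) = 0"
      unfolding set_lebesgue_integral_def
      by (rule integral_eq_zero_AE) (use vac in \<open>eventually_elim, auto simp: euler_flux_0 indicator_def\<close>)
    moreover have "?\<theta> (- a) = 1" by (simp add: plateau_eq_1)
    moreover have "?\<theta> a = 0" using bump a by (simp add: bump_def)
    ultimately have "?F UL + a *\<^sub>R UL = 0" by simp
    then have "?F UL $ 1 = - a * UL $ 1" "?F UL $ 2 = - a * UL $ 2"
      by (simp_all add: vec_eq_iff forall_3 eq_neg_iff_add_eq_0)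
    then have "pressure \<gamma> UL = 0" using UL by (simp add: euler_G_def power2_eq_square)
    then show False using UL by (simp add: euler_G_def)
  qed
  have fan: "(2 * a) *\<^sub>R lf_state ?F a UL UR = (LINT \<xi>:{- a..a}|lborel. W \<xi>)"
    using riemann_fan_balance[OF b a, of UL "?F UL" UR "?F UR"] lf_state_scaled[OF a, of ?F UL UR]
      self_similar_weak_equation[OF bump_plateau[of 1 "-a" a] b eq] out by simp
  have pos: "0 < L (lf_state ?F a UL UR)"
    if L: "bounded_linear L" and Lpos: "\<And>U. U \<in> euler_G \<gamma> \<Longrightarrow> 0 < L U" for L :: "real^3 \<Rightarrow> real"
  proof -
    interpret bounded_linear L by fact
    have int: "integrable lborel (\<lambda>\<xi>. indicator {-a..a} \<xi> *\<^sub>R W \<xi>)"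
    proof -
      obtain B where "\<And>\<xi>. norm (W \<xi>) \<le> B"
        using b(1) by (auto simp: bdd_measurable_def bounded_iff)
      then show ?thesis
        using b(1) by (intro integrableI_bounded_set_indicator[where B = B]) (auto simp: bdd_measurable_def emeasure_lborel_Icc_eq)
    qed
    have nn: "0 \<le> L (W \<xi>)" for \<xi> using range[of \<xi>] Lpos[of "W \<xi>"] by (auto simp: zero)
    have int': "integrable lborel (\<lambda>\<xi>. L (indicator {-a..a} \<xi> *\<^sub>R W \<xi>))"
      by (rule integrable_bounded_linear[OF L int])
    have nn': "0 \<le> L (indicator {-a..a} \<xi> *\<^sub>R W \<xi>)" for \<xi>
      using nn[of \<xi>] by (auto simp: indicator_def zero)
    have "2 * a * L (lf_state ?F a UL UR) = (LINT \<xi>|lborel. L (indicator {-a..a} \<xi> *\<^sub>R W \<xi>))"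
      using integral_bounded_linear[OF L int] scale[of "2 * a" "lf_state ?F a UL UR"] fan
      by (simp only: set_lebesgue_integral_def real_scaleR_def)
    moreover have "(LINT \<xi>|lborel. L (indicator {-a..a} \<xi> *\<^sub>R W \<xi>)) \<noteq> 0"
    proof
      assume "(LINT \<xi>|lborel. L (indicator {-a..a} \<xi> *\<^sub>R W \<xi>)) = 0"
      then have "AE \<xi> in lborel. L (indicator {-a..a} \<xi> *\<^sub>R W \<xi>) = 0"
        using integral_nonneg_eq_0_iff_AE[OF int'] nn' by simp
      then have "AE \<xi> in lborel. \<xi> \<in> {- a..a} \<longrightarrow> W \<xi> = 0"
      proof eventually_elim
        case (elim \<xi>)
        show ?case
        proof
          assume "\<xi> \<in> {-a..a}"
          then have "L (W \<xi>) = 0" using elim by simp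
          then show "W \<xi> = 0" using range[of \<xi>] Lpos[of "W \<xi>"] by auto
        qed
      qed
      then show False using no_vacuum by blast
    qed
    moreover have "0 \<le> (LINT \<xi>|lborel. L (indicator {-a..a} \<xi> *\<^sub>R W \<xi>))"
      using nn' by (intro integral_nonneg_AE) auto
    ultimately have "0 < 2 * a * L (lf_state ?F a UL UR)" by linarith
    then show ?thesis using a by (simp add: zero_less_mult_iff)
  qed
  show ?thesis
    unfolding euler_G_iff[OF \<gamma>]
    using pos[OF bounded_linear_vec_nth[of 1]] pos[OF bounded_linear_moving_energy] euler_G_iff[OF \<gamma>]
    by blast
qed

section \<open>The convex splitting of the cell averages and the Runge-Kutta method\<close>

lemma convex_combination3:
  assumes "convex G" "x \<in> G" "y \<in> G" "z \<in> G" "0 \<le> b" "0 \<le> c" "b + c \<le> (1::real)"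
  shows "(1 - b - c) *\<^sub>R x + b *\<^sub>R y + c *\<^sub>R z \<in> G"
proof (cases "b + c = 0")
  case True
  then have "b = 0" "c = 0" using assms by auto
  then show ?thesis using assms by simp
next
  case False
  let ?w = "(b / (b + c)) *\<^sub>R y + (c / (b + c)) *\<^sub>R z"
  have "?w \<in> G"
    using assms False by (intro convexD) (auto simp: add_divide_distrib[symmetric])
  then have "(1 - (b + c)) *\<^sub>R x + (b + c) *\<^sub>R ?w \<in> G"
    using assms(5-7) by (intro convexD[OF assms(1,2)]) auto
  moreover have "(b + c) *\<^sub>R ?w = b *\<^sub>R y + c *\<^sub>R z"
    using False by (simp add: scaleR_add_right del: scaleR_scaleR) simp
  ultimately show ?thesis by (simp add: diff_diff_eq add.assoc)
qed

lemma flux_low_left: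
  "\<alpha> i \<noteq> 0 \<Longrightarrow> flux_low F \<alpha> V i = F (avg V i) - \<alpha> i *\<^sub>R (U_tilde F \<alpha> V i - avg V i)"
  by (simp add: flux_low_def llf_flux_def U_tilde_def algebra_simps)
     (simp flip: scaleR_add_left)

lemma flux_low_right:
  "\<alpha> i \<noteq> 0 \<Longrightarrow> flux_low F \<alpha> V i = F (avg V (i + 1)) + \<alpha> i *\<^sub>R (U_tilde F \<alpha> V i - avg V (i + 1))"
  by (simp add: flux_low_def llf_flux_def U_tilde_def algebra_simps)
     (simp flip: scaleR_add_left)

text \<open>
  By the two preceding identities \<open>F (avg V i)\<close> cancels in the difference of the two low-order
  fluxes.  What is left is a combination of \<open>avg V i\<close> and the two corrected intermediate states with
  the weights \<open>1 - \<mu> * \<alpha> (i - 1) - \<mu> * \<alpha> i\<close>, \<open>\<mu> * \<alpha> (i - 1)\<close> and \<open>\<mu> * \<alpha> i\<close>, where \<open>\<mu> = dt / dx i\<close>; the first time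
  step restriction says that the first weight is nonnegative.
\<close>

lemma limited_avg_in_convex:
  assumes G: "convex G" and V: "avg V i \<in> G"
    and minus: "U_tilde F \<alpha> V i - (1 / \<alpha> i) *\<^sub>R corr \<alpha> V i \<in> G"
    and plus: "U_tilde F \<alpha> V (i - 1) + (1 / \<alpha> (i - 1)) *\<^sub>R corr \<alpha> V (i - 1) \<in> G"
    and \<alpha>: "0 < \<alpha> i" "0 < \<alpha> (i - 1)" and dx: "0 < dx i" and dt: "0 < dt"
    and cfl: "dt \<le> dx i / (\<alpha> (i - 1) + \<alpha> i)"
  shows "avg (limited_euler_step F dx l1 l2 R corr plim dt \<alpha> V) i \<in> G"
proof -
  define \<mu> where "\<mu> = dt / dx i"
  have \<mu>: "0 < \<mu>" "\<mu> * \<alpha> (i - 1) + \<mu> * \<alpha> i \<le> 1"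
    using dx dt cfl \<alpha> by (auto simp: \<mu>_def field_simps)
  let ?m = "\<mu> * \<alpha> (i - 1)" and ?p = "\<mu> * \<alpha> i"
  have "(1 - ?m - ?p) *\<^sub>R avg V i
     + ?m *\<^sub>R (U_tilde F \<alpha> V (i - 1) + (1 / \<alpha> (i - 1)) *\<^sub>R corr \<alpha> V (i - 1))
     + ?p *\<^sub>R (U_tilde F \<alpha> V i - (1 / \<alpha> i) *\<^sub>R corr \<alpha> V i) \<in> G"
    using G V plus minus \<mu> \<alpha> by (intro convex_combination3) auto
  also have "(1 - ?m - ?p) *\<^sub>R avg V i
     + ?m *\<^sub>R (U_tilde F \<alpha> V (i - 1) + (1 / \<alpha> (i - 1)) *\<^sub>R corr \<alpha> V (i - 1))
     + ?p *\<^sub>R (U_tilde F \<alpha> V i - (1 / \<alpha> i) *\<^sub>R corr \<alpha> V i) =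
     avg (limited_euler_step F dx l1 l2 R corr plim dt \<alpha> V) i"
    using \<alpha> by (simp add: limited_euler_step_def \<mu>_def[symmetric] flux_low_left[of \<alpha> i]
        flux_low_right[of \<alpha> "i - 1"] algebra_simps)
  finally show ?thesis .
qed

definition af_in :: "'a set \<Rightarrow> 'a af_data \<Rightarrow> bool" where
  "af_in G V \<longleftrightarrow> (\<forall>i. avg V i \<in> G \<and> pnt V i \<in> G)"

lemma af_in_comb:
  "convex G \<Longrightarrow> af_in G V \<Longrightarrow> af_in G W \<Longrightarrow> 0 \<le> a \<Longrightarrow> 0 \<le> b \<Longrightarrow> a + b = 1 \<Longrightarrow> af_in G (af_comb a V b W)"
  by (auto simp: af_in_def af_comb_def intro: convexD)

lemma af_in_ssp_rk3:
  assumes G: "convex G" and V: "af_in G V"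
    and step: "\<And>k. k < 3 \<Longrightarrow> af_in G (rk_stage E V k) \<Longrightarrow> af_in G (E k (rk_stage E V k))"
  shows "af_in G (ssp_rk3 E V)"
proof -
  have 1: "af_in G (E 0 V)" using step[of 0] V by simp
  have 2: "af_in G (E 1 (E 0 V))" using step[of 1] 1 by simp
  have "af_in G (rk_stage E V 2)" using af_in_comb[OF G V 2, of "3/4" "1/4"] by (simp add: numeral_2_eq_2)
  from step[OF _ this] have "af_in G (E 2 (rk_stage E V 2))" by simp
  from af_in_comb[OF G V this, of "1/3" "2/3"] show ?thesis by (simp add: ssp_rk3_def)
qed

lemma af_in_iterates:
  assumes G: "convex G" and V0: "af_in G (V 0)" and V: "\<And>n. V (Suc n) = ssp_rk3 (E n) (V n)"
    and step: "\<And>n k. k < 3 \<Longrightarrow> af_in G (rk_stage (E n) (V n) k) \<Longrightarrow> af_in G (E n k (rk_stage (E n) (V n) k))"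
  shows "af_in G (V n)"
proof (induction n)
  case (Suc n)
  have "af_in G (ssp_rk3 (E n) (V n))" by (rule af_in_ssp_rk3[OF G Suc]) (rule step)
  then show ?case by (simp add: V)
qed (rule V0)

section \<open>The maximum principle for scalar laws\<close>

text \<open>
  The same clipping serves both choices: the local bounds lie between \<open>m0\<close>, \<open>M0\<close> and the
  intermediate state, since they are extrema of averages and intermediate states that include the latter.
\<close>

lemma scalar_correction_bounds:
  assumes avg: "\<And>i. avg V i \<in> {m0..M0}" and tilde: "\<And>i. U_tilde f \<alpha> V i \<in> {m0..M0}" and \<alpha>: "0 < \<alpha> i"
  shows "\<bar>scalar_correction mp f m0 M0 \<alpha> V i\<bar> \<le> \<alpha> i * (U_tilde f \<alpha> V i - m0)"
    "\<bar>scalar_correction mp f m0 M0 \<alpha> V i\<bar> \<le> \<alpha> i * (M0 - U_tilde f \<alpha> V i)"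
proof -
  let ?u = "U_tilde f \<alpha> V i" and ?d = "flux_diff f \<alpha> V i"
  have clip: "\<bar>if 0 \<le> ?d then Min {?d, \<alpha> i * (?u - a), \<alpha> i * (b - ?u)}
        else Max {?d, \<alpha> i * (c - ?u), \<alpha> i * (?u - e)}\<bar>
      \<le> min (\<alpha> i * (?u - m0)) (\<alpha> i * (M0 - ?u))"
    if "a \<in> {m0..?u}" "c \<in> {m0..?u}" "b \<in> {?u..M0}" "e \<in> {?u..M0}" for a b c e
  proof -
    have "0 \<le> \<alpha> i * (?u - a)" "\<alpha> i * (?u - a) \<le> \<alpha> i * (?u - m0)"
      "0 \<le> \<alpha> i * (b - ?u)" "\<alpha> i * (b - ?u) \<le> \<alpha> i * (M0 - ?u)"
      "\<alpha> i * (c - ?u) \<le> 0" "\<alpha> i * (m0 - ?u) \<le> \<alpha> i * (c - ?u)"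
      "\<alpha> i * (?u - e) \<le> 0" "\<alpha> i * (?u - M0) \<le> \<alpha> i * (?u - e)"
      using that \<alpha> by (auto intro!: mult_nonneg_nonneg mult_nonneg_nonpos mult_left_mono)
    moreover have "\<alpha> i * (m0 - ?u) = - (\<alpha> i * (?u - m0))" "\<alpha> i * (?u - M0) = - (\<alpha> i * (M0 - ?u))"
      by (simp_all add: algebra_simps)
    ultimately show ?thesis by (auto simp: min_def max_def)
  qed
  have "\<bar>scalar_correction mp f m0 M0 \<alpha> V i\<bar> \<le> min (\<alpha> i * (?u - m0)) (\<alpha> i * (M0 - ?u))"
  proof (cases mp)
    case Global
    show ?thesis
      using clip[of m0 m0 M0 M0] tilde[of i] by (simp add: Global scalar_correction_def global_correction_def Let_def)
  next
    case Local
    have "local_min f \<alpha> V i \<in> {m0..?u}" "local_min f \<alpha> V (i + 1) \<in> {m0..?u}"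
      "local_max f \<alpha> V (i + 1) \<in> {?u..M0}" "local_max f \<alpha> V i \<in> {?u..M0}"
      using avg[of i] avg[of "i + 1"] tilde[of "i - 1"] tilde[of i] tilde[of "i + 1"]
      by (auto simp: local_min_def local_max_def)
    from clip[OF this] show ?thesis by (simp add: Local scalar_correction_def local_correction_def Let_def)
  qed
  then show "\<bar>scalar_correction mp f m0 M0 \<alpha> V i\<bar> \<le> \<alpha> i * (?u - m0)"
    "\<bar>scalar_correction mp f m0 M0 \<alpha> V i\<bar> \<le> \<alpha> i * (M0 - ?u)" by auto
qed

text \<open>
  When the limiter interferes, it moves the high-order value along the line to \<open>uL\<close> until it hits the
  violated bound exactly.
\<close>

lemma scalar_point_lim_between:
  assumes "scalar_point_lim_defined m0 M0 uL uH" "m0 \<le> M0"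
  shows "scalar_point_lim m0 M0 uL uH \<in> {m0..M0}"
proof -
  have lin: "(uL - m) / (uL - uH) * uH + (1 - (uL - m) / (uL - uH)) * uL = m" if "uL \<noteq> uH" for m
  proof -
    have "(uL - m) / (uL - uH) * (uL - uH) = uL - m" using that by simp
    then show ?thesis by (simp only: algebra_simps)
  qed
  have flip: "(M0 - uL) / (uH - uL) = (uL - M0) / (uL - uH)"
    by (metis minus_diff_eq minus_divide_divide)
  show ?thesis
    using assms lin by (auto simp: scalar_point_lim_def scalar_point_lim_defined_def Let_def flip)
qed

text \<open>
  The derivative is the limit of the difference quotients from \<open>a\<close> towards \<open>b\<close>, which convexity bounds
  by \<open>f b - f a\<close>.  The argument stays on the segment from \<open>a\<close> to \<open>b\<close>, so that \<open>a\<close> may be an endpoint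
  of the interval.
\<close>

lemma convex_on_tangent_le:
  assumes f: "convex_on {m..M} f" and D: "(f has_real_derivative D) (at a)"
    and a: "a \<in> {m..M}" and b: "b \<in> {m..M}"
  shows "D * (b - a) \<le> f b - f a"
proof -
  have "((\<lambda>t. a + t * (b - a)) has_real_derivative b - a) (at 0)"
    by (auto intro!: derivative_eq_intros)
  from DERIV_chain2[OF _ this, of f D]
  have "((\<lambda>t. f (a + t * (b - a))) has_real_derivative D * (b - a)) (at 0)" using D by simp
  then have "((\<lambda>t. (f (a + t * (b - a)) - f a) / t) \<longlongrightarrow> D * (b - a)) (at 0)"
    by (simp add: DERIV_def)
  then have "((\<lambda>t. (f (a + t * (b - a)) - f a) / t) \<longlongrightarrow> D * (b - a)) (at_right 0)"
    by (rule tendsto_mono[rotated]) (simp add: at_le)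
  moreover have "\<forall>\<^sub>F t in at_right 0. (f (a + t * (b - a)) - f a) / t \<le> f b - f a"
    using eventually_at_right_real[OF zero_less_one]
  proof eventually_elim
    case (elim t)
    have "f ((1 - t) *\<^sub>R a + t *\<^sub>R b) \<le> (1 - t) * f a + t * f b"
      using convex_onD[OF f, of t a b] elim a b by simp
    moreover have "(1 - t) *\<^sub>R a + t *\<^sub>R b = a + t * (b - a)" by (simp add: algebra_simps)
    ultimately show ?case using elim by (simp add: field_simps)
  qed
  ultimately show ?thesis by (rule tendsto_upperbound) simp
qed

text \<open>
  Where \<open>f'\<close> is monotone, its values at the two endpoints control it in between.  This is why a wave
  speed computed from the point values alone suffices for convex and concave fluxes.
\<close>

lemma convex_or_concave_lipschitz:
  assumes f: "convex_on {m..M} f \<or> concave_on {m..M} f"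
    and Da: "(f has_real_derivative Da) (at a)" and Db: "(f has_real_derivative Db) (at b)"
    and a: "a \<in> {m..M}" and b: "b \<in> {m..M}"
  shows "\<bar>f b - f a\<bar> \<le> max \<bar>Da\<bar> \<bar>Db\<bar> * \<bar>b - a\<bar>"
proof -
  have cv: "\<bar>f b - f a\<bar> \<le> max \<bar>Da\<bar> \<bar>Db\<bar> * \<bar>b - a\<bar>"
    if c: "convex_on {m..M} f" and Da: "(f has_real_derivative Da) (at a)"
      and Db: "(f has_real_derivative Db) (at b)" for f and Da Db :: real
  proof -
    have "Da * (b - a) \<le> f b - f a" "Db * (a - b) \<le> f a - f b"
      using convex_on_tangent_le[OF c Da a b] convex_on_tangent_le[OF c Db b a] .
    moreover have "\<bar>Da * (b - a)\<bar> \<le> max \<bar>Da\<bar> \<bar>Db\<bar> * \<bar>b - a\<bar>" "\<bar>Db * (a - b)\<bar> \<le> max \<bar>Da\<bar> \<bar>Db\<bar> * \<bar>b - a\<bar>"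
      by (auto simp: abs_mult abs_minus_commute intro!: mult_right_mono)
    ultimately show ?thesis by linarith
  qed
  from f show ?thesis
  proof
    assume "convex_on {m..M} f"
    then show ?thesis using cv Da Db by blast
  next
    assume "concave_on {m..M} f"
    then have "convex_on {m..M} (\<lambda>x. - f x)" by (simp add: concave_on_def)
    from cv[OF this DERIV_minus[OF Da] DERIV_minus[OF Db]]
    show ?thesis by (simp add: abs_minus_commute[of "f b"])
  qed
qed

lemma max_char_speed_real:
  assumes "(f has_real_derivative D) (at u)"
  shows "max_char_speed f u = \<bar>D\<bar>"
proof -
  have "frechet_derivative f (at u) = (\<lambda>h. D * h)"
    using frechet_derivative_at[OF has_field_derivative_imp_has_derivative[OF assms]] by simp
  then have "{\<bar>\<mu>\<bar> |\<mu>. \<exists>r. r \<noteq> 0 \<and> frechet_derivative f (at u) r = \<mu> *\<^sub>R r} = {\<bar>D\<bar>}"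
    by (auto intro: exI[of "\<lambda>r. r \<noteq> 0 \<and> _ r" 1])
  then show ?thesis by (simp add: max_char_speed_def)
qed

text \<open>
  The flux at the centre cancels between the two cells.  It is put back here, so that each neighbour
  contributes a term which vanishes when the neighbour agrees with the centre.
\<close>

lemma point_low_split:
  fixes F :: "'a::real_normed_vector \<Rightarrow> 'a"
  assumes "\<kappa> = 2 * dt / (dx i + dx (i + 1))"
  shows "point_low F dx dt V i = pnt V i
    + (\<kappa> / 2) *\<^sub>R (cell_speed F V (i + 1) *\<^sub>R (pnt V (i + 1) - pnt V i) - (F (pnt V (i + 1)) - F (pnt V i)))
    + (\<kappa> / 2) *\<^sub>R (cell_speed F V i *\<^sub>R (pnt V (i - 1) - pnt V i) + (F (pnt V (i - 1)) - F (pnt V i)))"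
  unfolding point_low_def point_flux_def llf_flux_def assms[symmetric]
  by (simp add: algebra_simps)

text \<open>
  Each neighbour contributes a multiple of its difference to the centre.  The Lipschitz bound makes that
  multiple nonnegative and at most \<open>\<kappa> * cell_speed\<close>, and the second time step restriction makes it at
  most 1/2, so that the update is a convex combination of three point values.
\<close>

lemma scalar_point_low_between:
  assumes f: "convex_on {m..M} f \<or> concave_on {m..M} f" and diff: "f differentiable_on UNIV"
    and V: "\<And>i. pnt V i \<in> {m..M}" and dx: "\<And>i. 0 < dx i" and dt: "0 < dt"
    and cfl: "dt * (4 * max (cell_speed f V i) (cell_speed f V (i + 1))) \<le> dx i + dx (i + 1)"
  shows "point_low f dx dt V i \<in> {m..M}"
proof -
  define \<kappa> where "\<kappa> = 2 * dt / (dx i + dx (i + 1))"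
  have dx2: "0 < dx i + dx (i + 1)" using dx by (simp add: add_pos_pos)
  have \<kappa>: "0 < \<kappa>" using dx2 dt by (simp add: \<kappa>_def)
  have lip: "\<bar>f (pnt V j) - f (pnt V (j - 1))\<bar> \<le> cell_speed f V j * \<bar>pnt V j - pnt V (j - 1)\<bar>" for j
  proof -
    obtain D where D: "\<And>x. (f has_real_derivative D x) (at x)"
      using diff by (metis UNIV_I differentiable_on_def real_differentiable_def)
    show ?thesis
      using convex_or_concave_lipschitz[OF f D D V V]
      by (simp add: cell_speed_def max_char_speed_real[OF D])
  qed
  have half: "\<kappa> * cell_speed f V j \<le> 1 / 2" if "j = i \<or> j = i + 1" for j
  proof -
    have "dt * (4 * cell_speed f V j) \<le> dt * (4 * max (cell_speed f V i) (cell_speed f V (i + 1)))"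
      using that dt by (intro mult_left_mono) auto
    then show ?thesis using cfl dx2 by (simp add: \<kappa>_def field_simps)
  qed
  have slope: "\<exists>s. 0 \<le> s \<and> s \<le> 1 / 2 \<and> \<kappa> / 2 * (c * y + z) = s * y"
    if "\<bar>z\<bar> \<le> c * \<bar>y\<bar>" "\<kappa> * c \<le> 1 / 2" for c y z
  proof (cases "y = 0")
    case True
    then show ?thesis using that by (intro exI[of _ 0]) auto
  next
    case False
    have "\<bar>z / y\<bar> \<le> c" using that(1) False by (simp add: field_simps)
    then have "- c \<le> z / y" "z / y \<le> c" by linarith+
    then have "0 \<le> c + z / y" "c + z / y \<le> 2 * c" by linarith+
    then have "\<kappa> / 2 * (c + z / y) \<le> \<kappa> / 2 * (2 * c)" "0 \<le> \<kappa> / 2 * (c + z / y)"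
      using \<kappa> by (intro mult_left_mono mult_nonneg_nonneg; simp)+
    moreover have "\<kappa> / 2 * (c * y + z) = \<kappa> / 2 * (c + z / y) * y"
      using False by (simp add: field_simps)
    moreover have "\<kappa> / 2 * (2 * c) \<le> 1 / 2" using that(2) by simp
    ultimately show ?thesis by (intro exI[of _ "\<kappa> / 2 * (c + z / y)"]) linarith
  qed
  obtain s where s: "0 \<le> s" "s \<le> 1 / 2" "\<kappa> / 2 * (cell_speed f V (i + 1) * (pnt V (i + 1) - pnt V i) +
      - (f (pnt V (i + 1)) - f (pnt V i))) = s * (pnt V (i + 1) - pnt V i)"
    using slope[OF _ half, of "- (f (pnt V (i + 1)) - f (pnt V i))" "i + 1" "pnt V (i + 1) - pnt V i"]
      lip[of "i + 1"] by (auto simp: abs_minus_commute)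
  obtain r where r: "0 \<le> r" "r \<le> 1 / 2" "\<kappa> / 2 * (cell_speed f V i * (pnt V (i - 1) - pnt V i) +
      (f (pnt V (i - 1)) - f (pnt V i))) = r * (pnt V (i - 1) - pnt V i)"
    using slope[OF _ half, of "f (pnt V (i - 1)) - f (pnt V i)" i "pnt V (i - 1) - pnt V i"]
      lip[of i] by (auto simp: abs_minus_commute)
  have "point_low f dx dt V i = pnt V i + s * (pnt V (i + 1) - pnt V i) + r * (pnt V (i - 1) - pnt V i)"
    unfolding point_low_split[OF \<kappa>_def] s(3)[symmetric] r(3)[symmetric]
    by (simp add: algebra_simps)
  also have "\<dots> = (1 - s - r) *\<^sub>R pnt V i + s *\<^sub>R pnt V (i + 1) + r *\<^sub>R pnt V (i - 1)"
    by (simp add: algebra_simps)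
  also have "\<dots> \<in> {m..M}"
    using V s r by (intro convex_combination3) auto
  finally show ?thesis .
qed

text \<open>
  Convexity or concavity enters only through the denominators of the point value limiter: \<open>uL\<close> lies in the
  interval and therefore differs from every \<open>uH\<close> outside of it.
\<close>

lemma scalar_step_in:
  assumes V: "af_in {m..M} V" and diff: "f differentiable_on UNIV"
    and sp: "speeds_valid f UNIV (kruzhkov_pairs f) \<alpha> V" and cfl: "cfl f dx dt \<alpha> V"
    and dx: "\<And>i. 0 < dx i" and dt: "0 < dt"
    and def: "\<not> (convex_on {m..M} f \<or> concave_on {m..M} f) \<Longrightarrow>
      \<forall>i. scalar_point_lim_defined m M (point_low f dx dt V i) (point_high l1 l2 R dt V i)"
  shows "af_in {m..M} (scalar_step f m M mp dx l1 l2 R dt \<alpha> V)"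
  unfolding af_in_def
proof (intro allI conjI)
  fix i
  have avg: "avg V j \<in> {m..M}" and pnt: "pnt V j \<in> {m..M}" for j using V by (auto simp: af_in_def)
  have \<alpha>: "0 < \<alpha> j" for j using sp by (simp add: speeds_valid_def)
  have cfl1: "dt \<le> dx i / (\<alpha> (i - 1) + \<alpha> i)"
    and cfl2: "dt * (4 * max (cell_speed f V j) (cell_speed f V (j + 1))) \<le> dx j + dx (j + 1)" for j
    using cfl by (auto simp: cfl_def)
  have tilde: "U_tilde f \<alpha> V j \<in> {m..M}" for j
    unfolding U_tilde_eq_lf_state
    using sp by (intro scalar_lf_state_between avg) (auto simp: speeds_valid_def)
  have corr: "U_tilde f \<alpha> V j - (1 / \<alpha> j) *\<^sub>R scalar_correction mp f m M \<alpha> V j \<in> {m..M}"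
    "U_tilde f \<alpha> V j + (1 / \<alpha> j) *\<^sub>R scalar_correction mp f m M \<alpha> V j \<in> {m..M}" for j
  proof -
    have "\<bar>scalar_correction mp f m M \<alpha> V j / \<alpha> j\<bar> \<le> U_tilde f \<alpha> V j - m"
      "\<bar>scalar_correction mp f m M \<alpha> V j / \<alpha> j\<bar> \<le> M - U_tilde f \<alpha> V j"
      using scalar_correction_bounds[where mp = mp and i = j, OF avg tilde \<alpha>] \<alpha>[of j]
      by (simp_all add: pos_divide_le_eq mult.commute)
    then have "m \<le> U_tilde f \<alpha> V j - scalar_correction mp f m M \<alpha> V j / \<alpha> j"
      "U_tilde f \<alpha> V j - scalar_correction mp f m M \<alpha> V j / \<alpha> j \<le> M"
      "m \<le> U_tilde f \<alpha> V j + scalar_correction mp f m M \<alpha> V j / \<alpha> j"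
      "U_tilde f \<alpha> V j + scalar_correction mp f m M \<alpha> V j / \<alpha> j \<le> M" by linarith+
    then show "U_tilde f \<alpha> V j - (1 / \<alpha> j) *\<^sub>R scalar_correction mp f m M \<alpha> V j \<in> {m..M}"
      "U_tilde f \<alpha> V j + (1 / \<alpha> j) *\<^sub>R scalar_correction mp f m M \<alpha> V j \<in> {m..M}"
      by auto
  qed
  show "avg (scalar_step f m M mp dx l1 l2 R dt \<alpha> V) i \<in> {m..M}"
    unfolding scalar_step_def
    by (intro limited_avg_in_convex avg corr \<alpha> dx dt cfl1) simp
  have "scalar_point_lim_defined m M (point_low f dx dt V i) (point_high l1 l2 R dt V i)"
  proof (cases "convex_on {m..M} f \<or> concave_on {m..M} f")
    case True
    have "point_low f dx dt V i \<in> {m..M}"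
      by (rule scalar_point_low_between[OF True diff pnt dx dt cfl2])
    then show ?thesis by (auto simp: scalar_point_lim_defined_def)
  qed (use def in blast)
  then show "pnt (scalar_step f m M mp dx l1 l2 R dt \<alpha> V) i \<in> {m..M}"
    using scalar_point_lim_between pnt[of i] by (fastforce simp: scalar_step_def limited_euler_step_def)
qed

section \<open>Euler equations: wave speeds and the low-order point values\<close>

lemma euler_G_add: "1 < \<gamma> \<Longrightarrow> U \<in> euler_G \<gamma> \<Longrightarrow> V \<in> euler_G \<gamma> \<Longrightarrow> U + V \<in> euler_G \<gamma>"
  by (simp add: euler_G_iff linear_add[OF bounded_linear.linear[OF bounded_linear_moving_energy]] add_pos_pos)

lemma euler_G_scale: "1 < \<gamma> \<Longrightarrow> U \<in> euler_G \<gamma> \<Longrightarrow> 0 < c \<Longrightarrow> c *\<^sub>R U \<in> euler_G \<gamma>"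
  by (simp add: euler_G_iff linear_scale[OF bounded_linear.linear[OF bounded_linear_moving_energy]])

lemma convex_euler_G: "1 < \<gamma> \<Longrightarrow> convex (euler_G \<gamma>)"
  unfolding convex_def
  by (metis add.right_neutral add_0 antisym_conv2 euler_G_add euler_G_scale scaleR_one scaleR_zero_left)

definition sound_speed :: "real \<Rightarrow> real^3 \<Rightarrow> real" where
  "sound_speed \<gamma> U = sqrt (\<gamma> * pressure \<gamma> U / U$1)"

lemma euler_flux_has_derivative:
  assumes "U$1 \<noteq> 0"
  shows "(euler_flux \<gamma> has_derivative (\<lambda>h.
     (h$2) *\<^sub>R axis 1 1 +
     (2 * (U$2 / U$1) * h$2 - (U$2 / U$1)\<^sup>2 * h$1 + (\<gamma> - 1) * (h$3 - 1 / 2 * (2 * (U$2 / U$1) * h$2 - (U$2 / U$1)\<^sup>2 * h$1))) *\<^sub>R axis 2 1 +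
     ((h$3 + (\<gamma> - 1) * (h$3 - 1 / 2 * (2 * (U$2 / U$1) * h$2 - (U$2 / U$1)\<^sup>2 * h$1))) * (U$2 / U$1) +
       (U$3 + pressure \<gamma> U) * (h$2 / U$1 - U$2 * h$1 / (U$1)\<^sup>2)) *\<^sub>R axis 3 1)) (at U)"
proof -
  have eq: "euler_flux \<gamma> = (\<lambda>U. U$2 *\<^sub>R axis 1 1 + (U$1 * (U$2 / U$1)\<^sup>2 + pressure \<gamma> U) *\<^sub>R axis 2 1 +
      ((U$3 + pressure \<gamma> U) * (U$2 / U$1)) *\<^sub>R axis 3 1)"
    by (simp add: fun_eq_iff vec_eq_iff forall_3 axis_def)
  have nth: "((\<lambda>U::real^3. U $ i) has_derivative (\<lambda>h. h $ i)) (at U)" for i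
    by (rule bounded_linear_imp_has_derivative[OF bounded_linear_vec_nth])
  have v: "((\<lambda>U::real^3. U$2 / U$1) has_derivative (\<lambda>h. h$2 / U$1 - U$2 * h$1 / (U$1)\<^sup>2)) (at U)"
    by (rule has_derivative_eq_rhs[OF has_derivative_divide'[OF nth nth assms]])
       (use assms in \<open>simp add: fun_eq_iff diff_divide_distrib power2_eq_square\<close>)
  have "((\<lambda>U::real^3. U$2 * (U$2 / U$1)) has_derivative
      (\<lambda>h. 2 * (U$2 / U$1) * h$2 - (U$2 / U$1)\<^sup>2 * h$1)) (at U)"
    by (rule has_derivative_eq_rhs[OF has_derivative_mult[OF nth v]])
       (simp add: fun_eq_iff right_diff_distrib power2_eq_square mult.commute mult.left_commute)
  moreover have "(\<lambda>U::real^3. U$2 * (U$2 / U$1)) = (\<lambda>U. U$1 * (U$2 / U$1)\<^sup>2)"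
    by (auto simp: fun_eq_iff power2_eq_square)
  ultimately have m: "((\<lambda>U::real^3. U$1 * (U$2 / U$1)\<^sup>2) has_derivative
      (\<lambda>h. 2 * (U$2 / U$1) * h$2 - (U$2 / U$1)\<^sup>2 * h$1)) (at U)"
    by simp
  have "pressure \<gamma> = (\<lambda>U. (\<gamma> - 1) * (U$3 - 1 / 2 * (U$1 * (U$2 / U$1)\<^sup>2)))"
    by (auto simp: fun_eq_iff pressure_def power2_eq_square)
  then have p: "(pressure \<gamma> has_derivative
      (\<lambda>h. (\<gamma> - 1) * (h$3 - 1 / 2 * (2 * (U$2 / U$1) * h$2 - (U$2 / U$1)\<^sup>2 * h$1)))) (at U)"
    by (simp only:) (intro has_derivative_mult_right has_derivative_diff nth m)
  show ?thesis
    unfolding eq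
    by (rule has_derivative_eq_rhs[OF has_derivative_add[OF has_derivative_add[OF
      has_derivative_scaleR_left[OF nth] has_derivative_scaleR_left[OF has_derivative_add[OF m p]]]
      has_derivative_scaleR_left[OF has_derivative_mult[OF has_derivative_add[OF nth p] v]]]])
      (simp add: fun_eq_iff algebra_simps)
qed

text \<open>
  The acoustic eigenvectors are \<open>(1, v + s, H + v * s)\<close> with the total enthalpy \<open>H\<close>; both signs are treated
  together as \<open>s\<close> with \<open>s\<^sup>2 = c\<^sup>2\<close>.  The supremum in \<open>max_char_speed\<close> is an upper bound of these
  eigenvalues because the operator norm of the derivative bounds them all.
\<close>

lemma euler_max_char_speed:
  assumes \<gamma>: "1 < \<gamma>" and U: "U \<in> euler_G \<gamma>"
  shows "\<bar>U$2 / U$1\<bar> + sound_speed \<gamma> U \<le> max_char_speed (euler_flux \<gamma>) U"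
proof -
  define v c H where "v = U$2 / U$1" and "c = sound_speed \<gamma> U" and "H = (U$3 + pressure \<gamma> U) / U$1"
  have \<rho>: "0 < U$1" and p: "0 < pressure \<gamma> U" using U by (auto simp: euler_G_def)
  have c2: "c\<^sup>2 = \<gamma> * pressure \<gamma> U / U$1" and c: "0 \<le> c"
    using \<rho> p \<gamma> by (auto simp: c_def sound_speed_def)
  let ?D = "frechet_derivative (euler_flux \<gamma>) (at U)"
  note D = euler_flux_has_derivative[of U \<gamma>, OF less_imp_neq[OF \<rho>, symmetric]]
  note Deq = frechet_derivative_at[OF D, symmetric]
  have bl: "bounded_linear ?D" unfolding Deq using D by (rule has_derivative_bounded_linear)
  have H: "H = c\<^sup>2 / (\<gamma> - 1) + v\<^sup>2 / 2"
    using \<rho> \<gamma> unfolding c2 H_def v_def pressure_def by (simp add: field_simps power2_eq_square)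
  have eig: "?D (vector [1, v + s, H + v * s]) = (v + s) *\<^sub>R vector [1, v + s, H + v * s]"
    if "s\<^sup>2 = c\<^sup>2" for s
  proof -
    have Up: "U$3 + pressure \<gamma> U = H * U$1" using \<rho> by (simp add: H_def)
    have m: "U$2 = v * U$1" using \<rho> by (simp add: v_def)
    have "(\<gamma> - 1) * (H - v\<^sup>2 / 2) = s\<^sup>2" using H \<gamma> that by (simp add: field_simps)
    then have 2: "2 * v * (v + s) - v\<^sup>2 * 1 + (\<gamma> - 1) * ((H + v * s) - 1 / 2 * (2 * v * (v + s) - v\<^sup>2 * 1)) = (v + s) * (v + s)"
      and g: "(\<gamma> - 1) * ((H + v * s) - 1 / 2 * (2 * v * (v + s) - v\<^sup>2 * 1)) = s\<^sup>2"
      by (simp_all add: algebra_simps power2_eq_square)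
    have 3: "(H + v * s + s\<^sup>2) * v + (H * U$1) * ((v + s) / U$1 - v * U$1 * 1 / (U$1)\<^sup>2) = (v + s) * (H + v * s)"
      using \<rho> by (simp add: field_simps power2_eq_square)
    show ?thesis
      unfolding Deq v_def[symmetric] Up
      using 2 3 g m by (simp add: vec_eq_iff forall_3 axis_def)
  qed
  have bdd: "bdd_above {\<bar>\<mu>\<bar> |\<mu>. \<exists>r. r \<noteq> 0 \<and> ?D r = \<mu> *\<^sub>R r}"
  proof (rule bdd_aboveI)
    fix x assume "x \<in> {\<bar>\<mu>\<bar> |\<mu>. \<exists>r. r \<noteq> 0 \<and> ?D r = \<mu> *\<^sub>R r}"
    then obtain \<mu> r where x: "x = \<bar>\<mu>\<bar>" and r: "r \<noteq> 0" "?D r = \<mu> *\<^sub>R r" by blast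
    have "\<bar>\<mu>\<bar> * norm r \<le> onorm ?D * norm r" using onorm[OF bl, of r] r by simp
    then show "x \<le> onorm ?D" using r x by simp
  qed
  have le: "\<bar>v + s\<bar> \<le> max_char_speed (euler_flux \<gamma>) U" if "s\<^sup>2 = c\<^sup>2" for s
    unfolding max_char_speed_def
  proof (rule cSup_upper[OF _ bdd])
    have "vector [1, v + s, H + v * s] \<noteq> (0::real^3)" by (simp add: vec_eq_iff forall_3)
    then show "\<bar>v + s\<bar> \<in> {\<bar>\<mu>\<bar> |\<mu>. \<exists>r. r \<noteq> 0 \<and> ?D r = \<mu> *\<^sub>R r}" using eig[OF that] by blast
  qed
  have "\<bar>v\<bar> + c \<le> max_char_speed (euler_flux \<gamma>) U"
    using le[of c] le[of "- c"] c by auto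
  then show ?thesis by (simp add: v_def c_def)
qed

text \<open>
  Let \<open>\<rho>\<close>, \<open>v\<close>, \<open>p\<close> be density, velocity and pressure of \<open>U\<close>, \<open>b = a + s * v\<close> and \<open>y = v - w\<close>.  The energy of
  \<open>a *\<^sub>R U + s *\<^sub>R euler_flux \<gamma> U\<close> seen by an observer of velocity \<open>w\<close> is
  \<open>b * (p / (\<gamma> - 1) + \<rho> * y\<^sup>2 / 2) + s * p * y\<close>: a transported part, \<open>b\<close> times the energy of \<open>U\<close>, and the work of
  the pressure.  As a quadratic in \<open>y\<close> this is positive if \<open>b\<^sup>2 > (\<gamma> - 1) * p / (2 * \<rho>)\<close>, which holds since \<open>b\<close>
  is at least the sound speed, whose square is \<open>\<gamma> * p / \<rho>\<close>.
\<close>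

lemma euler_flux_splitting:
  assumes \<gamma>: "1 < \<gamma>" and U: "U \<in> euler_G \<gamma>" and a: "\<bar>U$2 / U$1\<bar> + sound_speed \<gamma> U \<le> a" and s: "\<bar>s\<bar> = 1"
  shows "a *\<^sub>R U + s *\<^sub>R euler_flux \<gamma> U \<in> euler_G \<gamma>"
proof -
  define \<rho> v p where "\<rho> = U$1" and "v = U$2 / U$1" and "p = pressure \<gamma> U"
  have \<rho>: "0 < \<rho>" and p: "0 < p" using U by (auto simp: euler_G_def \<rho>_def p_def)
  have m: "U$2 = \<rho> * v" using \<rho> by (simp add: v_def \<rho>_def)
  have E: "U$3 = p / (\<gamma> - 1) + \<rho> * v\<^sup>2 / 2"
    using \<rho> \<gamma> by (simp add: p_def pressure_def v_def \<rho>_def field_simps power2_eq_square)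
  define b where "b = a + s * v"
  have s2: "s\<^sup>2 = 1" using s by (metis one_power2 power2_abs)
  have "\<bar>s * v\<bar> = \<bar>v\<bar>" using s by (simp add: abs_mult)
  then have b: "sound_speed \<gamma> U \<le> b" using a unfolding b_def v_def[symmetric] by linarith
  have c: "0 < sound_speed \<gamma> U" "(sound_speed \<gamma> U)\<^sup>2 = \<gamma> * p / \<rho>"
    using \<rho> p \<gamma> by (auto simp: sound_speed_def \<rho>_def p_def)
  have b0: "0 < b" using b c by linarith
  have "(sound_speed \<gamma> U)\<^sup>2 \<le> b\<^sup>2" using b c(1) by (intro power_mono) auto
  then have "\<gamma> * p \<le> b\<^sup>2 * \<rho>" unfolding c(2) using \<rho> by (simp add: field_simps)
  moreover have "0 < \<gamma> * p" using \<gamma> p by simp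
  then have "(\<gamma> - 1) * p / 2 < \<gamma> * p" using p by (simp add: algebra_simps)
  ultimately have disc: "(\<gamma> - 1) * p < 2 * \<rho> * b\<^sup>2" by (simp add: algebra_simps)
  have "0 < moving_energy w (a *\<^sub>R U + s *\<^sub>R euler_flux \<gamma> U)" for w
  proof -
    define y where "y = v - w"
    have "moving_energy w (a *\<^sub>R U + s *\<^sub>R euler_flux \<gamma> U) = b * (p / (\<gamma> - 1) + \<rho> * y\<^sup>2 / 2) + s * p * y"
      unfolding moving_energy_def b_def y_def
      using \<rho> by (simp add: E m p_def[symmetric] \<rho>_def[symmetric] algebra_simps power2_eq_square add_divide_distrib diff_divide_distrib)
    (* completing the square in y *)
    also have "\<dots> = b * \<rho> / 2 * (y + s * p / (b * \<rho>))\<^sup>2 + p / (2 * b * \<rho> * (\<gamma> - 1)) * (2 * \<rho> * b\<^sup>2 - (\<gamma> - 1) * p)"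
    proof -
      have "(y + s * p / (b * \<rho>))\<^sup>2 = y\<^sup>2 + 2 * s * y * p / (b * \<rho>) + p\<^sup>2 / (b * \<rho>)\<^sup>2"
        using s2 by (simp add: power2_sum power_divide power_mult_distrib)
      moreover have "b * (p / (\<gamma> - 1) + \<rho> * y\<^sup>2 / 2) + s * p * y =
        b * \<rho> / 2 * (y\<^sup>2 + 2 * s * y * p / (b * \<rho>) + p\<^sup>2 / (b * \<rho>)\<^sup>2) + p / (2 * b * \<rho> * (\<gamma> - 1)) * (2 * \<rho> * b\<^sup>2 - (\<gamma> - 1) * p)"
        using b0 \<rho> \<gamma> by (simp add: field_simps power2_eq_square)
      ultimately show ?thesis by simp
    qed
    also have "0 < \<dots>"
      using b0 \<rho> p \<gamma> disc by (intro add_nonneg_pos mult_pos_pos mult_nonneg_nonneg divide_pos_pos) auto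
    finally show ?thesis .
  qed
  moreover have "(a *\<^sub>R U + s *\<^sub>R euler_flux \<gamma> U) $ 1 = \<rho> * b"
    by (simp add: m b_def \<rho>_def[symmetric] algebra_simps)
  ultimately show ?thesis using \<rho> b0 by (simp add: euler_G_iff[OF \<gamma>] del: vector_add_component)
qed

text \<open>
  The update is \<open>(1 - \<kappa> / 2 * (cell_speed F V i + cell_speed F V (i + 1))) *\<^sub>R pnt V i\<close>
  plus positive multiples of states of the form treated in \<open>euler_flux_splitting\<close>, and \<open>euler_G \<gamma>\<close> is a convex cone.
\<close>

lemma euler_point_low_in_G:
  assumes \<gamma>: "1 < \<gamma>" and V: "\<And>i. pnt V i \<in> euler_G \<gamma>" and dx: "\<And>i. 0 < dx i" and dt: "0 < dt"
    and cfl: "dt * (4 * max (cell_speed (euler_flux \<gamma>) V i) (cell_speed (euler_flux \<gamma>) V (i + 1))) \<le> dx i + dx (i + 1)"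
  shows "point_low (euler_flux \<gamma>) dx dt V i \<in> euler_G \<gamma>"
proof -
  let ?F = "euler_flux \<gamma>"
  define \<kappa> where "\<kappa> = 2 * dt / (dx i + dx (i + 1))"
  let ?m = "cell_speed ?F V i" and ?p = "cell_speed ?F V (i + 1)"
  have dx2: "0 < dx i + dx (i + 1)" using dx by (simp add: add_pos_pos)
  have \<kappa>: "0 < \<kappa>" using dx2 dt by (simp add: \<kappa>_def)
  have "\<kappa> * (2 * max ?m ?p) \<le> 1" using cfl dx2 by (simp add: \<kappa>_def field_simps)
  moreover have "\<kappa> * (?m + ?p) \<le> \<kappa> * (2 * max ?m ?p)" using \<kappa> by (intro mult_left_mono) auto
  ultimately have w: "0 < 1 - \<kappa> / 2 * (?m + ?p)" by (simp add: algebra_simps)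
  have sp: "\<bar>pnt V j $ 2 / pnt V j $ 1\<bar> + sound_speed \<gamma> (pnt V j) \<le> cell_speed ?F V k"
    if "k = j \<or> k = j + 1" for j k
    using euler_max_char_speed[OF \<gamma> V, of j] that by (auto simp: cell_speed_def)
  have right: "?p *\<^sub>R pnt V (i + 1) + (- 1) *\<^sub>R ?F (pnt V (i + 1)) \<in> euler_G \<gamma>"
    by (intro euler_flux_splitting \<gamma> V sp) auto
  have left: "?m *\<^sub>R pnt V (i - 1) + 1 *\<^sub>R ?F (pnt V (i - 1)) \<in> euler_G \<gamma>"
    by (intro euler_flux_splitting \<gamma> V sp) auto
  have "(1 - \<kappa> / 2 * (?m + ?p)) *\<^sub>R pnt V i
      + (\<kappa> / 2) *\<^sub>R (?p *\<^sub>R pnt V (i + 1) + (- 1) *\<^sub>R ?F (pnt V (i + 1)))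
      + (\<kappa> / 2) *\<^sub>R (?m *\<^sub>R pnt V (i - 1) + 1 *\<^sub>R ?F (pnt V (i - 1))) \<in> euler_G \<gamma>"
    by (rule euler_G_add[OF \<gamma> euler_G_add[OF \<gamma> euler_G_scale[OF \<gamma> V w]
          euler_G_scale[OF \<gamma> right]] euler_G_scale[OF \<gamma> left]]) (use \<kappa> in simp_all)
  also have "(1 - \<kappa> / 2 * (?m + ?p)) *\<^sub>R pnt V i
      + (\<kappa> / 2) *\<^sub>R (?p *\<^sub>R pnt V (i + 1) + (- 1) *\<^sub>R ?F (pnt V (i + 1)))
      + (\<kappa> / 2) *\<^sub>R (?m *\<^sub>R pnt V (i - 1) + 1 *\<^sub>R ?F (pnt V (i - 1))) = point_low ?F dx dt V i"
    unfolding point_low_split[OF \<kappa>_def] by (simp add: algebra_simps)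
  finally show ?thesis .
qed

section \<open>Euler equations: the limiters\<close>

text \<open>
  The internal energy is a minimum of linear functions of the state.  An observer moving with the
  mixture \<open>W\<close> attains this minimum for \<open>W\<close>, while the energies of \<open>U\<close> and \<open>V\<close> in that frame are at
  least their internal energies.
\<close>

lemma pressure_concave:
  assumes \<gamma>: "1 < \<gamma>" and "0 < U$1" "0 < V$1" "0 \<le> t" "t \<le> 1"
  shows "t * pressure \<gamma> U + (1 - t) * pressure \<gamma> V \<le> pressure \<gamma> (t *\<^sub>R U + (1 - t) *\<^sub>R V)"
proof -
  let ?W = "t *\<^sub>R U + (1 - t) *\<^sub>R V"
  have W: "0 < ?W $ 1"
    using assms by (cases "t = 0") (auto intro!: add_pos_nonneg mult_pos_pos)
  define v where "v = ?W $ 2 / ?W $ 1"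
  have le: "pressure \<gamma> X / (\<gamma> - 1) \<le> moving_energy v X" if "0 < X $ 1" for X
    using that moving_energy_pressure[OF less_imp_neq[OF that, symmetric] \<gamma>, of v] by simp
  have "moving_energy v ?W = pressure \<gamma> ?W / (\<gamma> - 1)"
    using moving_energy_pressure[OF less_imp_neq[OF W, symmetric] \<gamma>, of v] by (simp add: v_def)
  moreover have "moving_energy v ?W = t * moving_energy v U + (1 - t) * moving_energy v V"
    by (simp add: moving_energy_def algebra_simps diff_divide_distrib)
  moreover have "t * (pressure \<gamma> U / (\<gamma> - 1)) + (1 - t) * (pressure \<gamma> V / (\<gamma> - 1)) \<le> t * moving_energy v U + (1 - t) * moving_energy v V"
    using assms by (intro add_mono mult_left_mono le) auto
  ultimately have "(t * pressure \<gamma> U + (1 - t) * pressure \<gamma> V) / (\<gamma> - 1) \<le> pressure \<gamma> ?W / (\<gamma> - 1)"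
    by (simp add: add_divide_distrib)
  then show ?thesis using \<gamma> by (simp add: divide_le_cancel)
qed

lemma set_density_nth [simp]:
  "set_density d U $ 1 = d" "set_density d U $ 2 = U $ 2" "set_density d U $ 3 = U $ 3"
  by (simp_all add: set_density_def)

text \<open>
  A factor that differs from 1 is the one for which interpolating the violated quantity linearly towards its
  value at \<open>UL\<close> hits the threshold.  The density attains the threshold exactly.  The pressure, being concave,
  lies at or above it.
\<close>

lemma euler_point_lim_in_G:
  assumes \<gamma>: "1 < \<gamma>" and UL: "UL \<in> euler_G \<gamma>"
  shows "euler_point_lim \<gamma> UL UH \<in> euler_G \<gamma>"
proof -
  have pos: "0 < UL$1" "0 < pressure \<gamma> UL" using UL by (auto simp: euler_G_def)
  define er ep where "er = min (1 / 10^13) (UL$1)" and "ep = min (1 / 10^13) (pressure \<gamma> UL)"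
  have er: "0 < er" "er \<le> UL$1" and ep: "0 < ep" "ep \<le> pressure \<gamma> UL"
    using pos by (auto simp: er_def ep_def)
  define \<theta>1 where "\<theta>1 = (if UH$1 < er then (UL$1 - er) / (UL$1 - UH$1) else 1)"
  define U where "U = set_density (\<theta>1 * UH$1 + (1 - \<theta>1) * UL$1) UH"
  define \<theta>2 where "\<theta>2 = (if pressure \<gamma> U < ep
                then (pressure \<gamma> UL - ep) / (pressure \<gamma> UL - pressure \<gamma> U) else 1)"
  have lim: "euler_point_lim \<gamma> UL UH = \<theta>2 *\<^sub>R U + (1 - \<theta>2) *\<^sub>R UL"
    unfolding euler_point_lim_def Let_def \<theta>2_def U_def \<theta>1_def er_def ep_def by simp
  have hit: "(l - e) / (l - h) * h + (1 - (l - e) / (l - h)) * l = e" if "h < e" "e \<le> l" for l e h :: real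
  proof -
    have "(l - e) / (l - h) * (l - h) = l - e" using that by simp
    then show ?thesis by (simp only: algebra_simps)
  qed
  have U1: "0 < U $ 1"
    using er hit[of "UH$1" er "UL$1"] by (auto simp: U_def \<theta>1_def)
  have \<theta>2: "0 \<le> \<theta>2" "\<theta>2 \<le> 1" using ep by (auto simp: \<theta>2_def)
  have "0 < \<theta>2 * pressure \<gamma> U + (1 - \<theta>2) * pressure \<gamma> UL"
    using ep hit[of "pressure \<gamma> U" ep "pressure \<gamma> UL"] by (auto simp: \<theta>2_def)
  also have "\<dots> \<le> pressure \<gamma> (\<theta>2 *\<^sub>R U + (1 - \<theta>2) *\<^sub>R UL)"
    by (rule pressure_concave[OF \<gamma> U1 pos(1) \<theta>2])
  finally have "0 < pressure \<gamma> (\<theta>2 *\<^sub>R U + (1 - \<theta>2) *\<^sub>R UL)" .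
  moreover have "0 < (\<theta>2 *\<^sub>R U + (1 - \<theta>2) *\<^sub>R UL) $ 1"
    using U1 pos(1) \<theta>2 by (cases "\<theta>2 = 0") (auto intro!: add_pos_nonneg mult_pos_pos)
  ultimately show ?thesis by (simp add: euler_G_def lim del: vector_add_component)
qed

text \<open>
  For \<open>0 \<le> t \<le> 1\<close> the expression is at least \<open>C - t * (\<bar>B\<bar> + max 0 A)\<close>, and \<open>t\<close> is cut off at the zero of
  this lower bound.
\<close>

lemma quadratic_limiter_bound:
  fixes A B C s :: real
  defines "d \<equiv> max 0 A + \<bar>B\<bar>"
  defines "t \<equiv> if d = 0 then 1 else min 1 (C / d)"
  assumes C: "0 \<le> C" and s: "\<bar>s\<bar> = 1"
  shows "0 \<le> t" "t \<le> 1" "0 \<le> C + s * t * B - t\<^sup>2 * A"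
proof -
  have d: "0 \<le> d" by (simp add: d_def)
  show t: "0 \<le> t" "t \<le> 1" using C d by (auto simp: t_def)
  have td: "t * d \<le> C"
    using C d by (cases "d = 0") (auto simp: t_def min_def field_simps)
  have "- (s * t * B) \<le> \<bar>s * t * B\<bar>" by linarith
  then have "- (s * t * B) \<le> t * \<bar>B\<bar>" using t s by (simp add: abs_mult)
  moreover have "t\<^sup>2 * A \<le> t * max 0 A"
  proof -
    have "t\<^sup>2 * A \<le> t\<^sup>2 * max 0 A" by (intro mult_left_mono) auto
    also have "\<dots> \<le> t * max 0 A"
      using t by (intro mult_right_mono) (auto simp: power2_eq_square intro: mult_left_le)
    finally show ?thesis .
  qed
  ultimately show "0 \<le> C + s * t * B - t\<^sup>2 * A" using td by (simp add: d_def algebra_simps)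
qed

text \<open>
  The clipped density correction keeps the density of the corrected state at or above its threshold
  for every factor in \<open>[0, 1]\<close>.  As for the pressure \<open>p\<close>, the product \<open>\<rho> * (p / (\<gamma> - 1) - \<epsilon>)\<close> with the density \<open>\<rho>\<close>
  is a quadratic polynomial in the state, and \<open>(\<alpha> i)\<^sup>2\<close> times its value at the corrected state is
  \<open>C + s * t * B - t\<^sup>2 * A\<close>.
\<close>

lemma euler_correction_in_G:
  assumes \<gamma>: "1 < \<gamma>" and \<alpha>: "0 < \<alpha> i" and U: "U_tilde (euler_flux \<gamma>) \<alpha> V i \<in> euler_G \<gamma>" and s: "\<bar>s\<bar> = 1"
  shows "U_tilde (euler_flux \<gamma>) \<alpha> V i + (s / \<alpha> i) *\<^sub>R euler_correction \<gamma> \<alpha> V i \<in> euler_G \<gamma>"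
proof -
  define U where "U = U_tilde (euler_flux \<gamma>) \<alpha> V i"
  define D where "D = euler_correction_star \<gamma> \<alpha> V i"
  define \<epsilon> where "\<epsilon> = min (1 / 10^13) (pressure \<gamma> U) / (\<gamma> - 1)"
  define A where "A = (1/2) * (D$2)\<^sup>2 - D$1 * D$3"
  define B where "B = \<alpha> i * (D$1 * U$3 + U$1 * D$3 - D$2 * U$2 - \<epsilon> * D$1)"
  define C where "C = (\<alpha> i)\<^sup>2 * (U$1 * U$3 - (1/2) * (U$2)\<^sup>2 - \<epsilon> * U$1)"
  define t where "t = (if max 0 A + \<bar>B\<bar> = 0 then 1 else min 1 (C / (max 0 A + \<bar>B\<bar>)))"
  have t_eq: "euler_theta \<gamma> \<alpha> V i = t"
    unfolding euler_theta_def Let_def t_def A_def B_def C_def \<epsilon>_def D_def U_def by simp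
  have \<rho>: "0 < U$1" and p: "0 < pressure \<gamma> U" using assms(3) by (auto simp: euler_G_def U_def)
  have \<epsilon>: "0 < \<epsilon>" "\<epsilon> \<le> pressure \<gamma> U / (\<gamma> - 1)"
    using p \<gamma> by (auto simp: \<epsilon>_def divide_right_mono)
  have internal: "X$1 * (pressure \<gamma> X / (\<gamma> - 1)) = X$1 * X$3 - (1/2) * (X$2)\<^sup>2" if "X$1 \<noteq> 0" for X
    using that \<gamma> by (simp add: pressure_def field_simps power2_eq_square)
  have "0 \<le> U$1 * (pressure \<gamma> U / (\<gamma> - 1) - \<epsilon>)" using \<rho> \<epsilon> by simp
  also have "\<dots> = U$1 * U$3 - (1/2) * (U$2)\<^sup>2 - \<epsilon> * U$1" using internal[of U] \<rho> by (simp add: algebra_simps)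
  finally have C: "0 \<le> C" by (simp add: C_def)
  note t = quadratic_limiter_bound[where A = A and B = B, OF C s, folded t_def]
  define W where "W = U + (s * t / \<alpha> i) *\<^sub>R D"
  have W1: "0 < W$1"
  proof -
    define e where "e = min (1 / 10^13) (U$1)"
    have e: "0 < e" "e \<le> U$1" using \<rho> by (auto simp: e_def)
    have "D$1 = (let d = flux_diff (euler_flux \<gamma>) \<alpha> V i $ 1 in if 0 \<le> d then min d (\<alpha> i * (U$1 - e)) else max d (\<alpha> i * (e - U$1)))"
      by (simp add: D_def euler_correction_star_def Let_def e_def U_def)
    moreover have "\<alpha> i * (e - U$1) = - (\<alpha> i * (U$1 - e))" "0 \<le> \<alpha> i * (U$1 - e)"
      using \<alpha> e by (simp_all add: algebra_simps)
    ultimately have "\<bar>D$1\<bar> \<le> \<alpha> i * (U$1 - e)" by (auto simp: Let_def)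
    then have "\<bar>D$1\<bar> / \<alpha> i \<le> U$1 - e" using \<alpha> by (simp add: pos_divide_le_eq mult.commute)
    moreover have "\<bar>s * t / \<alpha> i * D$1\<bar> \<le> \<bar>D$1\<bar> / \<alpha> i"
    proof -
      have "\<bar>s * t / \<alpha> i * D$1\<bar> = t * (\<bar>D$1\<bar> / \<alpha> i)" using s t \<alpha> by (simp add: abs_mult)
      also have "\<dots> \<le> 1 * (\<bar>D$1\<bar> / \<alpha> i)" using t \<alpha> by (intro mult_right_mono) auto
      finally show ?thesis by simp
    qed
    ultimately have "\<bar>s * t / \<alpha> i * D$1\<bar> \<le> U$1 - e" by (rule order.trans[rotated])
    from abs_le_D2[OF this] have "e \<le> U$1 + s * t / \<alpha> i * D$1" by (simp add: algebra_simps)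
    then show ?thesis using e by (simp add: W_def)
  qed
  have s2: "s * s = 1" using s by (metis abs_mult_self_eq mult_1)
  have scaled: "\<alpha> i * W $ j = \<alpha> i * U $ j + s * t * D $ j" for j
    using \<alpha> by (simp add: W_def algebra_simps)
  have "(\<alpha> i)\<^sup>2 * (W$1 * W$3 - (1/2) * (W$2)\<^sup>2 - \<epsilon> * W$1) =
      (\<alpha> i * W$1) * (\<alpha> i * W$3) - (1/2) * (\<alpha> i * W$2)\<^sup>2 - \<epsilon> * \<alpha> i * (\<alpha> i * W$1)"
    by (simp add: algebra_simps power2_eq_square)
  also have "\<dots> = C + s * t * B - (s * s) * t\<^sup>2 * A"
    unfolding scaled A_def B_def C_def by (simp add: algebra_simps power2_eq_square)
  also have "0 \<le> \<dots>" using t(3) s2 by simp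
  finally have "0 \<le> W$1 * W$3 - (1/2) * (W$2)\<^sup>2 - \<epsilon> * W$1" using \<alpha> by (simp add: zero_le_mult_iff)
  also have "\<dots> = W$1 * (pressure \<gamma> W / (\<gamma> - 1) - \<epsilon>)" using internal[of W] W1 by (simp add: algebra_simps)
  finally have "\<epsilon> \<le> pressure \<gamma> W / (\<gamma> - 1)" using W1 by (simp add: zero_le_mult_iff)
  then have "0 < pressure \<gamma> W / (\<gamma> - 1)" using \<epsilon> by linarith
  then have "0 < pressure \<gamma> W" using \<gamma> by (simp add: zero_less_divide_iff)
  then have "W \<in> euler_G \<gamma>" using W1 by (simp add: euler_G_def)
  also have "W = U + (s / \<alpha> i) *\<^sub>R euler_correction \<gamma> \<alpha> V i"
    by (simp add: W_def euler_correction_def t_eq D_def)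
  finally show ?thesis by (simp add: U_def)
qed

lemma euler_step_in:
  assumes \<gamma>: "1 < \<gamma>" and V: "af_in (euler_G \<gamma>) V"
    and sp: "speeds_valid (euler_flux \<gamma>) (euler_states \<gamma>) P \<alpha> V" and cfl: "cfl (euler_flux \<gamma>) dx dt \<alpha> V"
    and dx: "\<And>i. 0 < dx i" and dt: "0 < dt"
  shows "af_in (euler_G \<gamma>) (euler_step \<gamma> dx l1 l2 R dt \<alpha> V)"
  unfolding af_in_def
proof (intro allI conjI)
  fix i
  have avg: "avg V j \<in> euler_G \<gamma>" and pnt: "pnt V j \<in> euler_G \<gamma>" for j using V by (auto simp: af_in_def)
  have \<alpha>: "0 < \<alpha> j" for j using sp by (simp add: speeds_valid_def)
  have cfl1: "dt \<le> dx i / (\<alpha> (i - 1) + \<alpha> i)"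
    and cfl2: "dt * (4 * max (cell_speed (euler_flux \<gamma>) V i) (cell_speed (euler_flux \<gamma>) V (i + 1))) \<le> dx i + dx (i + 1)"
    using cfl by (auto simp: cfl_def)
  have tilde: "U_tilde (euler_flux \<gamma>) \<alpha> V j \<in> euler_G \<gamma>" for j
    unfolding U_tilde_eq_lf_state
    using sp by (intro euler_lf_state_in_G[OF \<gamma>] avg) (auto simp: speeds_valid_def)
  show "avg (euler_step \<gamma> dx l1 l2 R dt \<alpha> V) i \<in> euler_G \<gamma>"
    unfolding euler_step_def
    using euler_correction_in_G[of \<gamma> \<alpha> i V "-1"] euler_correction_in_G[of \<gamma> \<alpha> "i - 1" V 1]
    by (intro limited_avg_in_convex convex_euler_G \<gamma> avg \<alpha> dx dt cfl1) (simp_all add: \<gamma> \<alpha> tilde)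
  show "pnt (euler_step \<gamma> dx l1 l2 R dt \<alpha> V) i \<in> euler_G \<gamma>"
    by (simp add: euler_step_def limited_euler_step_def euler_point_lim_in_G \<gamma>
        euler_point_low_in_G pnt dx dt cfl2)
qed

theorem theorem4p1:
  fixes dx :: "int \<Rightarrow> real" and dt :: "nat \<Rightarrow> real" and l1 l2 :: nat
  assumes dx_pos: "\<And>i. 0 < dx i" and dt_pos: "\<And>n. 0 < dt n"
  shows
    "(\<forall>(f :: real \<Rightarrow> real) (u0 :: real \<Rightarrow> real) m0 M0 mp R (\<alpha> :: nat \<Rightarrow> nat \<Rightarrow> int \<Rightarrow> real)
       (V :: nat \<Rightarrow> real af_data).
       let E = (\<lambda>n k. scalar_step f m0 M0 mp dx l1 l2 R (dt n) (\<alpha> n k));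
           stage = (\<lambda>n k. rk_stage (E n) (V n) k)
       in f differentiable_on UNIV \<longrightarrow>
          m0 \<in> range u0 \<and> (\<forall>x. m0 \<le> u0 x) \<longrightarrow>
          M0 \<in> range u0 \<and> (\<forall>x. u0 x \<le> M0) \<longrightarrow>
          (\<forall>i. avg (V 0) i \<in> {m0..M0} \<and> pnt (V 0) i \<in> {m0..M0}) \<longrightarrow>
          (\<forall>n. V (Suc n) = ssp_rk3 (E n) (V n)) \<longrightarrow>
          (\<forall>n. \<forall>k<3. speeds_valid f UNIV (kruzhkov_pairs f) (\<alpha> n k) (stage n k) \<and>
                    cfl f dx (dt n) (\<alpha> n k) (stage n k)) \<longrightarrow>
          (\<not> (convex_on {m0..M0} f \<or> concave_on {m0..M0} f) \<longrightarrow>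
            (\<forall>n. \<forall>k<3. \<forall>i. scalar_point_lim_defined m0 M0
               (point_low f dx (dt n) (stage n k) i)
               (point_high l1 l2 R (dt n) (stage n k) i))) \<longrightarrow>
          (\<forall>n i. m0 \<le> avg (V n) i \<and> avg (V n) i \<le> M0 \<and> m0 \<le> pnt (V n) i \<and> pnt (V n) i \<le> M0))
     \<and>
     (\<forall>(\<gamma> :: real) R (\<alpha> :: nat \<Rightarrow> nat \<Rightarrow> int \<Rightarrow> real) (V :: nat \<Rightarrow> (real^3) af_data).
       let E = (\<lambda>n k. euler_step \<gamma> dx l1 l2 R (dt n) (\<alpha> n k));
           stage = (\<lambda>n k. rk_stage (E n) (V n) k)
       in 1 < \<gamma> \<longrightarrow>
          (\<forall>i. avg (V 0) i \<in> euler_G \<gamma> \<and> pnt (V 0) i \<in> euler_G \<gamma>) \<longrightarrow>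
          (\<forall>n. V (Suc n) = ssp_rk3 (E n) (V n)) \<longrightarrow>
          (\<forall>n. \<forall>k<3. speeds_valid (euler_flux \<gamma>) (euler_states \<gamma>) (euler_entropy_pair \<gamma>)
                      (\<alpha> n k) (stage n k) \<and>
                    cfl (euler_flux \<gamma>) dx (dt n) (\<alpha> n k) (stage n k)) \<longrightarrow>
          (\<forall>n i. 0 < avg (V n) i $ 1 \<and> 0 < pressure \<gamma> (avg (V n) i) \<and>
                 0 < pnt (V n) i $ 1 \<and> 0 < pressure \<gamma> (pnt (V n) i)))"
proof (intro conjI allI, unfold Let_def; intro impI allI)
  fix f u0 :: "real \<Rightarrow> real" and m0 M0 :: real and mp R and \<alpha> :: "nat \<Rightarrow> nat \<Rightarrow> int \<Rightarrow> real" and V :: "nat \<Rightarrow> real af_data"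
    and n :: nat and i :: int
  let ?E = "\<lambda>n k. scalar_step f m0 M0 mp dx l1 l2 R (dt n) (\<alpha> n k)"
  assume diff: "f differentiable_on UNIV"
    and V0: "\<forall>i. avg (V 0) i \<in> {m0..M0} \<and> pnt (V 0) i \<in> {m0..M0}"
    and V: "\<forall>n. V (Suc n) = ssp_rk3 (?E n) (V n)"
    and sp: "\<forall>n. \<forall>k<3. speeds_valid f UNIV (kruzhkov_pairs f) (\<alpha> n k) (rk_stage (?E n) (V n) k) \<and>
                    cfl f dx (dt n) (\<alpha> n k) (rk_stage (?E n) (V n) k)"
    and def: "\<not> (convex_on {m0..M0} f \<or> concave_on {m0..M0} f) \<longrightarrow>
            (\<forall>n. \<forall>k<3. \<forall>i. scalar_point_lim_defined m0 M0
               (point_low f dx (dt n) (rk_stage (?E n) (V n) k) i)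
               (point_high l1 l2 R (dt n) (rk_stage (?E n) (V n) k) i))"
  have "af_in {m0..M0} (V n)"
  proof (rule af_in_iterates[where E = ?E])
    show "af_in {m0..M0} (V 0)" using V0 by (simp add: af_in_def)
    show "af_in {m0..M0} (?E n k (rk_stage (?E n) (V n) k))"
      if "k < 3" "af_in {m0..M0} (rk_stage (?E n) (V n) k)" for n k
      using that sp def by (intro scalar_step_in diff dx_pos dt_pos) blast+
  qed (use V in simp_all)
  then show "m0 \<le> avg (V n) i \<and> avg (V n) i \<le> M0 \<and> m0 \<le> pnt (V n) i \<and> pnt (V n) i \<le> M0"
    by (simp add: af_in_def)
next
  fix \<gamma> :: real and R and \<alpha> :: "nat \<Rightarrow> nat \<Rightarrow> int \<Rightarrow> real" and V :: "nat \<Rightarrow> (real^3) af_data" and n :: nat and i :: int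
  let ?E = "\<lambda>n k. euler_step \<gamma> dx l1 l2 R (dt n) (\<alpha> n k)"
  assume \<gamma>: "1 < \<gamma>"
    and V0: "\<forall>i. avg (V 0) i \<in> euler_G \<gamma> \<and> pnt (V 0) i \<in> euler_G \<gamma>"
    and V: "\<forall>n. V (Suc n) = ssp_rk3 (?E n) (V n)"
    and sp: "\<forall>n. \<forall>k<3. speeds_valid (euler_flux \<gamma>) (euler_states \<gamma>) (euler_entropy_pair \<gamma>)
                      (\<alpha> n k) (rk_stage (?E n) (V n) k) \<and>
                    cfl (euler_flux \<gamma>) dx (dt n) (\<alpha> n k) (rk_stage (?E n) (V n) k)"
  have "af_in (euler_G \<gamma>) (V n)"
  proof (rule af_in_iterates[where E = ?E])
    show "af_in (euler_G \<gamma>) (V 0)" using V0 by (simp add: af_in_def)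
    show "af_in (euler_G \<gamma>) (?E n k (rk_stage (?E n) (V n) k))"
      if "k < 3" "af_in (euler_G \<gamma>) (rk_stage (?E n) (V n) k)" for n k
      using that sp by (intro euler_step_in[OF \<gamma>] dx_pos dt_pos) blast+
  qed (use V in \<open>simp_all add: convex_euler_G[OF \<gamma>]\<close>)
  then show "0 < avg (V n) i $ 1 \<and> 0 < pressure \<gamma> (avg (V n) i) \<and>
                 0 < pnt (V n) i $ 1 \<and> 0 < pressure \<gamma> (pnt (V n) i)"
    by (simp add: af_in_def euler_G_def)
qed

end
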